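(* Let $\mathcal{M}$ be the Bregman manifold of a regular Bregman generator $\Omega$ on an open convex set $\mathcal{X}\subset\mathbb{R}^d$ with dual domain $\mathcal{Y}$. Let $\rho\in\mathcal{P}(\mathcal{M})$ and let $Dh:\mathcal{Y}\to\mathcal{X}$ and $Df:\mathcal{X}\to\mathcal{Y}$ be smooth convex gradients (gradients of convex functions $h$ on $\mathcal{Y}$ and $f$ on $\mathcal{X}$). Let $(\mu_t)_{0\le t\le1}$ be the primal displacement interpolation started at $\mu_0=\rho$ and induced by $Dh$, and let $(\nu_t)_{0\le t\le 1}$ be the dual displacement interpolation started at $\nu_0=\rho$ and induced by $Df$, i.e. $$\mu_t^{\mathcal{X}}=((1-t)D\Omega^*+tDh)_\#\mu_0^{\mathcal{Y}},\qquad \nu_t^{\mathcal{Y}}=((1-t)D\Omega+tDf)_\#\nu_0^{\mathcal{X}}.$$ Assume that each of the pairs $(\rho,\mu_1)$ and $(\rho,\nu_1)$ satisfies the following conditions on a pair $(\alpha_0,\alpha_1)$ of elements of $\mathcal{P}(\mathcal{M})$: (a) $\alpha_0^{\mathcal{X}}$ is absolutely continuous with respect to Lebesgue measure on $\mathcal{X}$; (b) $\Omega\in L^1(\alpha_0^{\mathcal{X}})$ and $\Omega^*\in L^1(\alpha_1^{\mathcal{Y}})$. That is, $\rho^{\mathcal{X}}$ is absolutely continuous, $\Omega\in L^1(\rho^{\mathcal{X}})$, $\Omega^*\in L^1(\mu_1^{\mathcal{Y}})$ and $\Omega^*\in L^1(\nu_1^{\mathcal{Y}})$. Then for $0\le t<1$,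 $$\mathscr{B}(\rho,\nu_t)+\mathscr{B}(\mu_t,\rho)-\mathscr{B}(\mu_t,\nu_t)\ \ge\ t^2\,\mathfrak{g}(\dot\mu_0,\dot\nu_0),$$ where $$\mathfrak{g}(\dot\mu_0,\dot\nu_0):=\int_{\mathcal{M}}g\big(\operatorname{grad}\,[(f-\Omega)\circ\iota],\ \operatorname{grad}\,[(h-\Omega^* )\circ\iota^*]\big)\,d\rho$$ is Otto's Riemannian inner product between the primal and dual displacement interpolations at time zero. Furthermore, when $\dim\mathcal{M}=1$, equality holds in the inequality.
   Context: $D$ and $D^2$ denote Euclidean gradient and Hessian. A regular Bregman generator on an open convex set $\mathcal{X}\subset\mathbb{R}^d$ is a smooth convex function $\Omega:\mathcal{X}\to\mathbb{R}$ with $D^2\Omega$ positive definite everywhere and with $\mathcal{Y}:=D\Omega(\mathcal{X})$ (the dual domain) convex. Then $D\Omega:\mathcal{X}\to\mathcal{Y}$ is a diffeomorphism with inverse $D\Omega^*$, where $\Omega^*(y)=x\cdot y-\Omega(x)$ for $y=D\Omega(x)$. The Bregman manifold $\mathcal{M}$ is the smooth $d$-dimensional manifold with two global charts $\iota:\mathcal{M}\to\mathcal{X}$ (primal) and $\iota^*=D\Omega\circ\iota:\mathcal{M}\to\mathcal{Y}$ (dual); write $x_p=\iota(p)$, $y_p=\iota^*(p)$. The Bregman divergence is $\mathbf{B}(p,q)=\Omega(x_p)+\Omega^*(y_q)-x_p\cdot y_q$. The Riemannian metric $g$ on $\mathcal{M}$ is given by $g(\partial_{x^i},\partial_{x^j})|_p=D_{ij}\Omega(x_p)$,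 equivalently $g(\partial_{y^i},\partial_{y^j})|_p=D_{ij}\Omega^*(y_p)$, and $\operatorname{grad}$ is the Riemannian gradient with respect to $g$. $\mathcal{P}(\mathcal{M})$ denotes the Borel probability measures on $\mathcal{M}$. For $\mu\in\mathcal{P}(\mathcal{M})$, $\mu^{\mathcal{X}}=\iota_\#\mu$ and $\mu^{\mathcal{Y}}=(\iota^* )_\#\mu$ (pushforwards). The Bregman-Wasserstein divergence is $\mathscr{B}(\mu,\nu)=\inf_{\pi\in\Pi(\mu,\nu)}\int_{\mathcal{M}\times\mathcal{M}}\mathbf{B}(p,q)\,d\pi(p,q)$, where $\Pi(\mu,\nu)$ is the set of couplings of $\mu$ and $\nu$.
   Formalization: The divergences may be infinite under (a),(b), so the left side can be ∞−∞: the equality for dim M = 1 is claimed only when the left side is not ∞−∞, and the inequality is read in the extended reals with ∞−∞ = ∞. *)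

theory Defs
  imports "HOL-Probability.Probability"
begin

section \<open>Euclidean calculus\<close>

definition egrad :: "('a::euclidean_space \<Rightarrow> real) \<Rightarrow> 'a \<Rightarrow> 'a" where
  "egrad f x = (THE d. GDERIV f x :> d)"

definition hessian :: "(real^'n \<Rightarrow> real) \<Rightarrow> real^'n \<Rightarrow> real^'n^'n" where
  "hessian f x = jacobian (egrad f) (at x)"

definition positive_definite :: "real^'n^'n \<Rightarrow> bool" where
  "positive_definite A \<longleftrightarrow> transpose A = A \<and> (\<forall>v. v \<noteq> 0 \<longrightarrow> v \<bullet> (A *v v) > 0)"

text \<open>To be used on open sets \<open>S\<close>: all iterated directional derivatives up to order \<open>k\<close> exist and
  are continuous on \<open>S\<close>.\<close>

primrec Ck_on :: "nat \<Rightarrow> ('a::euclidean_space \<Rightarrow> 'b::euclidean_space) \<Rightarrow> 'a set \<Rightarrow> bool" where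
  "Ck_on 0 f S \<longleftrightarrow> continuous_on S f"
| "Ck_on (Suc k) f S \<longleftrightarrow> (\<forall>x\<in>S. f differentiable (at x)) \<and>
     (\<forall>v. Ck_on k (\<lambda>x. frechet_derivative f (at x) v) S)"

definition smooth_on :: "'a set \<Rightarrow> ('a::euclidean_space \<Rightarrow> 'b::euclidean_space) \<Rightarrow> bool" where
  "smooth_on S f \<longleftrightarrow> (\<forall>k. Ck_on k f S)"

text \<open>The map \<open>egrad f\<close> is a smooth convex gradient from \<open>S\<close> to \<open>T\<close>, with convex potential \<open>f\<close>.\<close>

definition smooth_convex_gradient ::
  "'a set \<Rightarrow> 'a set \<Rightarrow> ('a::euclidean_space \<Rightarrow> real) \<Rightarrow> bool" where
  "smooth_convex_gradient S T f \<longleftrightarrow>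
     convex_on S f \<and> (\<forall>x\<in>S. f differentiable (at x)) \<and>
     smooth_on S (egrad f) \<and> egrad f ` S \<subseteq> T"

section \<open>Bregman manifolds\<close>

definition dual_domain :: "(real^'n) set \<Rightarrow> (real^'n \<Rightarrow> real) \<Rightarrow> (real^'n) set" where
  "dual_domain X \<Omega> = egrad \<Omega> ` X"

definition regular_bregman_generator :: "(real^'n) set \<Rightarrow> (real^'n \<Rightarrow> real) \<Rightarrow> bool" where
  "regular_bregman_generator X \<Omega> \<longleftrightarrow>
     open X \<and> convex X \<and> smooth_on X \<Omega> \<and> convex_on X \<Omega> \<and>
     (\<forall>x\<in>X. positive_definite (hessian \<Omega> x)) \<and> convex (dual_domain X \<Omega>)"

definition dual_generator :: "(real^'n) set \<Rightarrow> (real^'n \<Rightarrow> real) \<Rightarrow> real^'n \<Rightarrow> real" where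
  "dual_generator X \<Omega> y = (let x = inv_into X (egrad \<Omega>) y in x \<bullet> y - \<Omega> x)"

text \<open>A Bregman manifold is a topological space \<open>M\<close> with the smooth structure of one global chart
  \<open>\<iota>\<close> onto \<open>X\<close>; the dual chart is compatible with it because \<open>egrad \<Omega>\<close> is a
  diffeomorphism of \<open>X\<close> onto the dual domain.\<close>

definition bregman_manifold ::
  "'m topology \<Rightarrow> ('m \<Rightarrow> real^'n) \<Rightarrow> (real^'n) set \<Rightarrow> (real^'n \<Rightarrow> real) \<Rightarrow> bool" where
  "bregman_manifold M \<iota> X \<Omega> \<longleftrightarrow>
     regular_bregman_generator X \<Omega> \<and> homeomorphic_map M (top_of_set X) \<iota>"

definition dual_chart :: "('m \<Rightarrow> real^'n) \<Rightarrow> (real^'n \<Rightarrow> real) \<Rightarrow> 'm \<Rightarrow> real^'n" where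
  "dual_chart \<iota> \<Omega> = egrad \<Omega> \<circ> \<iota>"

definition bregman_div ::
  "('m \<Rightarrow> real^'n) \<Rightarrow> (real^'n) set \<Rightarrow> (real^'n \<Rightarrow> real) \<Rightarrow> 'm \<Rightarrow> 'm \<Rightarrow> real" where
  "bregman_div \<iota> X \<Omega> p q =
     \<Omega> (\<iota> p) + dual_generator X \<Omega> (dual_chart \<iota> \<Omega> q) - \<iota> p \<bullet> dual_chart \<iota> \<Omega> q"

text \<open>A tangent vector of \<open>M\<close> at \<open>p\<close> is represented by its components with respect to the
  primal coordinate frame \<open>\<partial>/\<partial>x\<^sup>i\<close> at \<open>p\<close>, which is global.\<close>

definition bregman_metric ::
  "('m \<Rightarrow> real^'n) \<Rightarrow> (real^'n \<Rightarrow> real) \<Rightarrow> 'm \<Rightarrow> real^'n \<Rightarrow> real^'n \<Rightarrow> real" where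
  "bregman_metric \<iota> \<Omega> p u v =
     (\<Sum>i\<in>UNIV. \<Sum>j\<in>UNIV. hessian \<Omega> (\<iota> p) $ i $ j * u $ i * v $ j)"

definition mdifferential ::
  "'m topology \<Rightarrow> ('m \<Rightarrow> real^'n) \<Rightarrow> ('m \<Rightarrow> real) \<Rightarrow> 'm \<Rightarrow> real^'n \<Rightarrow> real" where
  "mdifferential M \<iota> \<phi> p v =
     frechet_derivative (\<phi> \<circ> inv_into (topspace M) \<iota>) (at (\<iota> p)) v"

definition riemannian_grad ::
  "'m topology \<Rightarrow> ('m \<Rightarrow> real^'n) \<Rightarrow> (real^'n \<Rightarrow> real) \<Rightarrow> ('m \<Rightarrow> real) \<Rightarrow> 'm \<Rightarrow> real^'n" where
  "riemannian_grad M \<iota> \<Omega> \<phi> p =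
     (THE u. \<forall>v. bregman_metric \<iota> \<Omega> p u v = mdifferential M \<iota> \<phi> p v)"

section \<open>Probability measures, couplings and transport\<close>

definition borel_probs :: "'m topology \<Rightarrow> 'm measure set" where
  "borel_probs M =
     {\<mu>. prob_space \<mu> \<and> sets \<mu> = sets (sigma (topspace M) {U. openin M U})}"

definition primal_law :: "('m \<Rightarrow> real^'n) \<Rightarrow> (real^'n) set \<Rightarrow> 'm measure \<Rightarrow> (real^'n) measure" where
  "primal_law \<iota> X \<mu> = distr \<mu> (restrict_space borel X) \<iota>"

definition dual_law ::
  "('m \<Rightarrow> real^'n) \<Rightarrow> (real^'n) set \<Rightarrow> (real^'n \<Rightarrow> real) \<Rightarrow> 'm measure \<Rightarrow> (real^'n) measure" where
  "dual_law \<iota> X \<Omega> \<mu> = distr \<mu> (restrict_space borel (dual_domain X \<Omega>)) (dual_chart \<iota> \<Omega>)"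

definition couplings :: "'a measure \<Rightarrow> 'b measure \<Rightarrow> ('a \<times> 'b) measure set" where
  "couplings \<mu> \<nu> =
     {\<pi>. prob_space \<pi> \<and> sets \<pi> = sets (\<mu> \<Otimes>\<^sub>M \<nu>) \<and> distr \<pi> \<mu> fst = \<mu> \<and> distr \<pi> \<nu> snd = \<nu>}"

text \<open>The Lebesgue integral with values in the extended reals. It is meaningful for measurable \<open>f\<close>
  whose positive or negative part has a finite integral; otherwise it is
  \<open>\<infinity> - \<infinity> = \<infinity>\<close>.\<close>

definition ext_integral :: "'a measure \<Rightarrow> ('a \<Rightarrow> real) \<Rightarrow> ereal" where
  "ext_integral \<mu> f =
     enn2ereal (\<integral>\<^sup>+x. ennreal (f x) \<partial>\<mu>) - enn2ereal (\<integral>\<^sup>+x. ennreal (- f x) \<partial>\<mu>)"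

definition BW_div ::
  "('m \<Rightarrow> real^'n) \<Rightarrow> (real^'n) set \<Rightarrow> (real^'n \<Rightarrow> real) \<Rightarrow> 'm measure \<Rightarrow> 'm measure \<Rightarrow> ereal" where
  "BW_div \<iota> X \<Omega> \<mu> \<nu> =
     (INF \<pi>\<in>couplings \<mu> \<nu>. ext_integral \<pi> (\<lambda>(p, q). bregman_div \<iota> X \<Omega> p q))"

definition admissible_pair ::
  "('m \<Rightarrow> real^'n) \<Rightarrow> (real^'n) set \<Rightarrow> (real^'n \<Rightarrow> real) \<Rightarrow> 'm measure \<Rightarrow> 'm measure \<Rightarrow> bool" where
  "admissible_pair \<iota> X \<Omega> \<alpha>0 \<alpha>1 \<longleftrightarrow>
     absolutely_continuous (restrict_space lborel X) (primal_law \<iota> X \<alpha>0) \<and>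
     integrable (primal_law \<iota> X \<alpha>0) \<Omega> \<and>
     integrable (dual_law \<iota> X \<Omega> \<alpha>1) (dual_generator X \<Omega>)"

definition primal_displacement_interpolation ::
  "'m topology \<Rightarrow> ('m \<Rightarrow> real^'n) \<Rightarrow> (real^'n) set \<Rightarrow> (real^'n \<Rightarrow> real) \<Rightarrow> (real^'n \<Rightarrow> real) \<Rightarrow>
   (real \<Rightarrow> 'm measure) \<Rightarrow> bool" where
  "primal_displacement_interpolation M \<iota> X \<Omega> h \<mu> \<longleftrightarrow>
     (\<forall>t\<in>{0..1}. \<mu> t \<in> borel_probs M \<and>
        primal_law \<iota> X (\<mu> t) =
          distr (dual_law \<iota> X \<Omega> (\<mu> 0)) (restrict_space borel X)
            (\<lambda>y. (1 - t) *\<^sub>R egrad (dual_generator X \<Omega>) y + t *\<^sub>R egrad h y))"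

definition dual_displacement_interpolation ::
  "'m topology \<Rightarrow> ('m \<Rightarrow> real^'n) \<Rightarrow> (real^'n) set \<Rightarrow> (real^'n \<Rightarrow> real) \<Rightarrow> (real^'n \<Rightarrow> real) \<Rightarrow>
   (real \<Rightarrow> 'm measure) \<Rightarrow> bool" where
  "dual_displacement_interpolation M \<iota> X \<Omega> f \<nu> \<longleftrightarrow>
     (\<forall>t\<in>{0..1}. \<nu> t \<in> borel_probs M \<and>
        dual_law \<iota> X \<Omega> (\<nu> t) =
          distr (primal_law \<iota> X (\<nu> 0)) (restrict_space borel (dual_domain X \<Omega>))
            (\<lambda>x. (1 - t) *\<^sub>R egrad \<Omega> x + t *\<^sub>R egrad f x))"

text \<open>Otto's inner product at time zero of the primal interpolation induced by \<open>egrad h\<close> and the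
  dual interpolation induced by \<open>egrad f\<close>, both started at \<open>\<rho>\<close>. It can be \<open>-\<infinity>\<close> or
  \<open>\<infinity>\<close>, hence the extended integral.\<close>

definition otto_inner ::
  "'m topology \<Rightarrow> ('m \<Rightarrow> real^'n) \<Rightarrow> (real^'n) set \<Rightarrow> (real^'n \<Rightarrow> real) \<Rightarrow>
   (real^'n \<Rightarrow> real) \<Rightarrow> (real^'n \<Rightarrow> real) \<Rightarrow> 'm measure \<Rightarrow> ereal" where
  "otto_inner M \<iota> X \<Omega> h f \<rho> =
     ext_integral \<rho> (\<lambda>p. bregman_metric \<iota> \<Omega> p
       (riemannian_grad M \<iota> \<Omega> ((\<lambda>x. f x - \<Omega> x) \<circ> \<iota>) p)
       (riemannian_grad M \<iota> \<Omega> ((\<lambda>y. h y - dual_generator X \<Omega> y) \<circ> dual_chart \<iota> \<Omega>) p))"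

text \<open>Excludes differences \<open>\<infinity> - \<infinity>\<close>, to which \<open>ereal\<close> assigns the value \<open>\<infinity>\<close>.
  Admissible pairs can have infinite divergence: take \<open>\<Omega> x = ln (1 + exp x)\<close> on the real line,
  \<open>f x = x / 4 + \<Omega> x / 2\<close>, \<open>h\<close> the dual generator, and \<open>\<rho>\<close> whose primal law has an integrable
  positive part but a negative part of infinite mean. Then the divergences from \<open>\<rho> = \<mu> t\<close> to
  \<open>\<nu> t\<close>, which occur with both signs, are infinite for \<open>0 < t < 1\<close>.\<close>

definition defined_diff :: "ereal \<Rightarrow> ereal \<Rightarrow> bool" where
  "defined_diff a b \<longleftrightarrow> \<not> (a = \<infinity> \<and> b = \<infinity>) \<and> \<not> (a = -\<infinity> \<and> b = -\<infinity>)"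

end

theory Submission
  imports Defs
begin

text \<open>
Write \<open>S\<close> for the gradient of \<open>\<Omega>\<close> and, in the primal chart, \<open>U x = (1 - t) x + t Dh (S x)\<close> and
\<open>T x = (1 - t) S x + t Df x\<close>. If \<open>x\<close> is distributed like \<open>\<rho>\<close>, then the point with primal
coordinate \<open>U x\<close> has law \<open>\<mu> t\<close> and the point with dual coordinate \<open>T x\<close> has law \<open>\<nu> t\<close>. So \<open>x\<close>
couples \<open>\<rho>\<close>, \<open>\<mu> t\<close> and \<open>\<nu> t\<close> all at once, and the three divergences can be compared under this one
coupling. Pointwise, all terms with \<open>\<Omega>\<close> and its dual cancel:

  \<open>B(x, T x) + B(U x, x) - B(U x, T x) = (U x - x) \<bullet> (T x - S x) = t\<^sup>2 (Dh (S x) - x) \<bullet> (Df x - S x)\<close>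

(\<open>divergence_defect\<close>), and the inner product on the right is the metric applied to the two
Riemannian gradients, since in primal coordinates these are \<open>H\<^sup>-\<^sup>1 (Df x - S x)\<close>, with \<open>H\<close> the Hessian
of \<open>\<Omega>\<close>, and \<open>Dh (S x) - x\<close> (\<open>otto_integrand_eq\<close>).

The coupling is optimal for \<open>(\<rho>, \<nu> t)\<close> and for \<open>(\<mu> t, \<rho>)\<close>: minimizing the Bregman cost means
maximizing the expected pairing of a primal with a dual coordinate, \<open>T\<close> is the gradient of the convex
function \<open>(1 - t) \<Omega> + t f\<close>, and \<open>U\<close> as a function of the dual coordinate is the gradient of
\<open>(1 - t) \<Omega>\<^sup>* + t h\<close>; these functions are Kantorovich potentials. For the third pair \<open>(\<mu> t, \<nu> t)\<close> the
coupling is only one competitor, so \<open>BW_div\<close> is at most its cost; integrating the pointwise identity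
gives the inequality. In dimension one \<open>U\<close> and \<open>T\<close> are both increasing, hence \<open>T\<close> is an increasing
function of \<open>U\<close>, its antiderivative is a convex potential, the coupling is optimal for the third pair as
well, and equality holds.

The potentials may fail to be integrable. Optimality is therefore derived from truncated
potentials (\<open>coupling_optimal_if_potentials\<close>), which uses that the cost is nonnegative. For measurability
the potentials are pulled back along \<open>U\<close> and along \<open>S\<^sup>-\<^sup>1 \<circ> T\<close>; for \<open>t < 1\<close> both maps are injective, because
the terms with weight \<open>1 - t\<close> are strictly monotone, and invariance of domain makes them homeomorphisms
onto open sets. If one of the first two divergences is infinite, the left-hand side is \<open>\<infinity>\<close>; otherwise
only the cost of the third coupling can be infinite, and the integral of the difference is well defined.
It is also well defined when the third cost is finite and the sum of the first two is not, which is the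
remaining case of the equality in dimension one.
\<close>

section \<open>Gradients of convex functions\<close>

lemma egrad_eqI:
  assumes "GDERIV f x :> d"
  shows "egrad f x = d"
  unfolding egrad_def
proof (rule the_equality)
  show "GDERIV f x :> d" by (rule assms)
next
  fix e assume "GDERIV f x :> e"
  with assms have "(\<lambda>h. h \<bullet> e) = (\<lambda>h. h \<bullet> d)"
    unfolding gderiv_def by (metis has_derivative_unique)
  then show "e = d"
    by (metis vector_eq_ldot)
qed

lemma GDERIV_egrad:
  assumes "f differentiable (at x)"
  shows "GDERIV f x :> egrad f x"
proof -
  obtain f' where f': "(f has_derivative f') (at x)"
    using assms by (auto simp: differentiable_def)
  then have "linear f'"
    by (rule has_derivative_linear)
  then have "f' = (\<lambda>h. h \<bullet> adjoint f' 1)"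
    by (simp add: adjoint_works)
  with f' have "GDERIV f x :> adjoint f' 1"
    unfolding gderiv_def by simp
  then show ?thesis
    using egrad_eqI by metis
qed

lemma frechet_derivative_egrad:
  assumes "f differentiable (at x)"
  shows "frechet_derivative f (at x) v = v \<bullet> egrad f x"
  using frechet_derivative_at[OF GDERIV_egrad[OF assms, unfolded gderiv_def]] by metis

text \<open>On \<open>X\<close> the gradient is \<open>\<Sum>b. f'(z; b) b\<close> over the Euclidean basis, and a smooth function has
differentiable directional derivatives.\<close>

lemma egrad_differentiable:
  assumes "open X" "smooth_on X f" "x \<in> X"
  shows "egrad f differentiable (at x)"
proof -
  have f: "f differentiable (at z)" if "z \<in> X" for z
    using assms(2) that unfolding smooth_on_def by (metis Ck_on.simps(2))
  have f2: "(\<lambda>z. frechet_derivative f (at z) v) differentiable (at x)" for v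
    using assms(2,3) unfolding smooth_on_def by (metis Ck_on.simps(2))
  have "(\<lambda>z. \<Sum>b\<in>Basis. frechet_derivative f (at z) b *\<^sub>R b) differentiable (at x)"
    by (intro differentiable_sum finite_Basis ballI differentiable_scaleR f2 differentiable_const)
  then obtain D where
    "((\<lambda>z. \<Sum>b\<in>Basis. frechet_derivative f (at z) b *\<^sub>R b) has_derivative D) (at x)"
    by (auto simp: differentiable_def)
  then have "(egrad f has_derivative D) (at x)"
  proof (rule has_derivative_transform_within_open[OF _ assms(1,3)])
    fix z assume "z \<in> X"
    then show "(\<Sum>b\<in>Basis. frechet_derivative f (at z) b *\<^sub>R b) = egrad f z"
      by (simp add: frechet_derivative_egrad[OF f] inner_commute[of _ "egrad f z"]
          euclidean_representation)
  qed
  then show ?thesis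
    by (auto simp: differentiable_def)
qed

text \<open>The difference quotients of \<open>f\<close> along the segment from \<open>x\<close> to \<open>y\<close> are bounded by \<open>f y - f x\<close>.\<close>

lemma convex_on_gradient_inequality:
  assumes "convex_on S f" "GDERIV f x :> d" "x \<in> S" "y \<in> S"
  shows "f x + d \<bullet> (y - x) \<le> f y"
proof -
  define g where "g = (\<lambda>s::real. f (x + s *\<^sub>R (y - x)))"
  have "((\<lambda>s. x + s *\<^sub>R (y - x)) has_derivative (\<lambda>s. s *\<^sub>R (y - x))) (at 0)"
    by (auto intro!: derivative_eq_intros)
  moreover have "(f has_derivative (\<lambda>h. h \<bullet> d)) (at (x + 0 *\<^sub>R (y - x)))"
    using assms(2) by (simp add: gderiv_def)
  ultimately have "(g has_derivative (\<lambda>s. (s *\<^sub>R (y - x)) \<bullet> d)) (at 0)"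
    unfolding g_def by (rule has_derivative_compose)
  moreover have "(\<lambda>s. (s *\<^sub>R (y - x)) \<bullet> d) = (*) (d \<bullet> (y - x))"
    by (auto simp: inner_commute)
  ultimately have "(g has_real_derivative d \<bullet> (y - x)) (at 0)"
    by (simp add: has_field_derivative_def)
  then have "((\<lambda>s. (g (0 + s) - g 0) / s) \<longlongrightarrow> d \<bullet> (y - x)) (at 0)"
    by (simp add: DERIV_def)
  then have lim: "((\<lambda>s. (g (0 + s) - g 0) / s) \<longlongrightarrow> d \<bullet> (y - x)) (at_right 0)"
    by (rule tendsto_within_subset) simp
  have "eventually (\<lambda>s::real. 0 < s \<and> s < 1) (at_right 0)"
    by (auto simp: eventually_at_right_field intro!: exI[of _ 1])
  then have "eventually (\<lambda>s. (g (0 + s) - g 0) / s \<le> f y - f x) (at_right 0)"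
  proof eventually_elim
    case (elim s)
    have "g s = f ((1 - s) *\<^sub>R x + s *\<^sub>R y)"
      by (simp add: g_def algebra_simps)
    also have "\<dots> \<le> (1 - s) * f x + s * f y"
      using elim assms by (intro convex_onD) auto
    finally have "g s - g 0 \<le> (f y - f x) * s"
      by (simp add: g_def algebra_simps)
    then show ?case
      using elim by (simp add: divide_le_eq)
  qed
  then have "d \<bullet> (y - x) \<le> f y - f x"
    by (intro tendsto_upperbound[OF lim]) auto
  then show ?thesis by simp
qed

lemma convex_gradient_monotone:
  assumes "convex_on S f" "GDERIV f x :> d" "GDERIV f y :> e" "x \<in> S" "y \<in> S"
  shows "0 \<le> (e - d) \<bullet> (y - x)"
  using convex_on_gradient_inequality[OF assms(1,2,4,5)]
    convex_on_gradient_inequality[OF assms(1,3,5,4)]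
  by (simp add: algebra_simps)

section \<open>Optimality of couplings with dual potentials\<close>

definition clamp_abs :: "real \<Rightarrow> real \<Rightarrow> real" where
  "clamp_abs c x = max (- c) (min c x)"

lemma clamp_abs_sum_nonneg: "0 \<le> c \<Longrightarrow> 0 \<le> x + y \<Longrightarrow> 0 \<le> clamp_abs c x + clamp_abs c y"
  by (auto simp: clamp_abs_def max_def min_def)

lemma clamp_abs_sum_le: "0 \<le> c \<Longrightarrow> clamp_abs c x + clamp_abs c y \<le> max 0 (x + y)"
  by (auto simp: clamp_abs_def max_def min_def)

lemma clamp_abs_bound: "0 \<le> c \<Longrightarrow> \<bar>clamp_abs c x\<bar> \<le> c"
  by (auto simp: clamp_abs_def max_def min_def)

lemma clamp_abs_tendsto: "(\<lambda>n. clamp_abs (real n) x) \<longlonglongrightarrow> x"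
proof (rule tendsto_eventually)
  show "eventually (\<lambda>n. clamp_abs (real n) x = x) sequentially"
    using eventually_ge_at_top[of "nat \<lceil>\<bar>x\<bar>\<rceil>"]
  proof eventually_elim
    case (elim n)
    then have "\<bar>x\<bar> \<le> real n" by linarith
    then show ?case by (auto simp: clamp_abs_def)
  qed
qed

lemma borel_measurable_clamp_abs[measurable]:
  "f \<in> borel_measurable N \<Longrightarrow> (\<lambda>x. clamp_abs c (f x)) \<in> borel_measurable N"
  unfolding clamp_abs_def
  by (intro borel_measurable_max borel_measurable_min borel_measurable_const)

lemma ennreal_integral_le_nn_integral:
  fixes f :: "'a \<Rightarrow> real"
  assumes "integrable N f"
  shows "ennreal (\<integral>x. f x \<partial>N) \<le> (\<integral>\<^sup>+x. ennreal (f x) \<partial>N)"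
proof -
  have i: "integrable N (\<lambda>x. max 0 (f x))"
    using assms by auto
  have "ennreal (\<integral>x. f x \<partial>N) \<le> ennreal (\<integral>x. max 0 (f x) \<partial>N)"
    by (intro ennreal_leI integral_mono assms i) auto
  also have "\<dots> = (\<integral>\<^sup>+x. ennreal (max 0 (f x)) \<partial>N)"
    by (intro nn_integral_eq_integral[symmetric] i) auto
  also have "\<dots> = (\<integral>\<^sup>+x. ennreal (f x) \<partial>N)"
    by (intro nn_integral_cong) (auto simp: max_def ennreal_neg)
  finally show ?thesis .
qed

text \<open>The easy half of Kantorovich duality without integrability of the potentials. If \<open>a\<close> and \<open>b\<close> are
integrable, integrate \<open>a u + b v \<le> c (u, v)\<close> against \<open>\<pi>\<close>, note that the left-hand integral depends on the
marginals only, and evaluate it on the graph \<open>(P, Q)\<close>, where equality holds. In general, clamp \<open>a\<close> and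
\<open>b\<close> to \<open>[-n, n]\<close>: the clamped sum never exceeds the positive part of \<open>a + b\<close>, hence not \<open>c\<close> either, as
\<open>c\<close> is nonnegative; on the graph \<open>a + b = c\<close> is nonnegative, so the clamped sums are nonnegative and
converge to \<open>c\<close>, and Fatou's lemma applies.\<close>

lemma coupling_optimal_if_potentials:
  fixes c :: "'u \<times> 'v \<Rightarrow> real"
  assumes R: "prob_space R"
    and P: "P \<in> measurable R N1" "P \<in> space R \<rightarrow> A" "A \<in> sets N1"
    and Q: "Q \<in> measurable R N2" "Q \<in> space R \<rightarrow> B" "B \<in> sets N2"
    and a: "a \<in> borel_measurable N1" and b: "b \<in> borel_measurable N2"
    and c_nonneg: "\<And>u v. u \<in> A \<Longrightarrow> v \<in> B \<Longrightarrow> 0 \<le> c (u, v)"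
    and le: "\<And>u v. u \<in> A \<Longrightarrow> v \<in> B \<Longrightarrow> a u + b v \<le> c (u, v)"
    and eq: "\<And>w. w \<in> space R \<Longrightarrow> a (P w) + b (Q w) = c (P w, Q w)"
    and \<pi>: "\<pi> \<in> couplings (distr R N1 P) (distr R N2 Q)"
  shows "(\<integral>\<^sup>+w. ennreal (c (P w, Q w)) \<partial>R) \<le> (\<integral>\<^sup>+z. ennreal (c z) \<partial>\<pi>)"
proof -
  interpret R: prob_space R by (rule R)
  interpret \<pi>: prob_space \<pi> using \<pi> by (simp add: couplings_def)
  note [measurable] = P(1) Q(1) a b P(3) Q(3)
  let ?\<mu> = "distr R N1 P" and ?\<nu> = "distr R N2 Q"
  have sets_\<pi>: "sets \<pi> = sets (N1 \<Otimes>\<^sub>M N2)"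
    and fst_\<pi>: "distr \<pi> ?\<mu> fst = ?\<mu>" and snd_\<pi>: "distr \<pi> ?\<nu> snd = ?\<nu>"
    using \<pi> by (auto simp: couplings_def cong: sets_pair_measure_cong)
  have [measurable]: "fst \<in> measurable \<pi> N1" "snd \<in> measurable \<pi> N2"
    using sets_\<pi> by (simp_all cong: measurable_cong_sets)
  have [measurable]: "fst \<in> measurable \<pi> ?\<mu>" "snd \<in> measurable \<pi> ?\<nu>"
    by simp_all
  \<comment> \<open>A coupling lives on \<open>A \<times> B\<close> up to a null set, because its marginals live on \<open>A\<close> and \<open>B\<close>.\<close>
  have "AE u in ?\<mu>. u \<in> A"
    using P by (subst AE_distr_iff) (auto simp: Int_def[symmetric] Pi_iff)
  then have "AE u in distr \<pi> ?\<mu> fst. u \<in> A"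
    by (simp only: fst_\<pi>)
  then have "AE z in \<pi>. fst z \<in> A"
    by (rule AE_distrD[rotated]) simp
  moreover have "AE v in ?\<nu>. v \<in> B"
    using Q by (subst AE_distr_iff) (auto simp: Pi_iff)
  then have "AE v in distr \<pi> ?\<nu> snd. v \<in> B"
    by (simp only: snd_\<pi>)
  then have "AE z in \<pi>. snd z \<in> B"
    by (rule AE_distrD[rotated]) simp
  ultimately have AE_AB: "AE z in \<pi>. fst z \<in> A \<and> snd z \<in> B"
    by auto
  define g where "g n w = clamp_abs (real n) (a (P w)) + clamp_abs (real n) (b (Q w))" for n :: nat and w
  define k where "k n z = clamp_abs (real n) (a (fst z)) + clamp_abs (real n) (b (snd z))" for n :: nat and z
  have g_eq_k: "ennreal (\<integral>w. g n w \<partial>R) = ennreal (\<integral>z. k n z \<partial>\<pi>)"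
    and k_int: "integrable \<pi> (k n)" and g_int: "integrable R (g n)" for n
  proof -
    have bounded: "integrable R (\<lambda>w. clamp_abs (real n) (a (P w)))"
      "integrable R (\<lambda>w. clamp_abs (real n) (b (Q w)))"
      "integrable \<pi> (\<lambda>z. clamp_abs (real n) (a (fst z)))"
      "integrable \<pi> (\<lambda>z. clamp_abs (real n) (b (snd z)))"
      by (auto intro!: R.integrable_const_bound[where B="real n"]
          \<pi>.integrable_const_bound[where B="real n"] AE_I2 simp: clamp_abs_bound)
    then show "integrable \<pi> (k n)" "integrable R (g n)"
      by (auto simp: k_def[abs_def] g_def[abs_def])
    have "(\<integral>w. clamp_abs (real n) (a (P w)) \<partial>R) = (\<integral>u. clamp_abs (real n) (a u) \<partial>?\<mu>)"
      by (subst integral_distr) auto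
    also have "\<dots> = (\<integral>u. clamp_abs (real n) (a u) \<partial>distr \<pi> ?\<mu> fst)"
      by (simp only: fst_\<pi>)
    also have "\<dots> = (\<integral>z. clamp_abs (real n) (a (fst z)) \<partial>\<pi>)"
      by (subst integral_distr) auto
    finally have 1: "(\<integral>w. clamp_abs (real n) (a (P w)) \<partial>R)
        = (\<integral>z. clamp_abs (real n) (a (fst z)) \<partial>\<pi>)" .
    have "(\<integral>w. clamp_abs (real n) (b (Q w)) \<partial>R) = (\<integral>u. clamp_abs (real n) (b u) \<partial>?\<nu>)"
      by (subst integral_distr) auto
    also have "\<dots> = (\<integral>u. clamp_abs (real n) (b u) \<partial>distr \<pi> ?\<nu> snd)"
      by (simp only: snd_\<pi>)
    also have "\<dots> = (\<integral>z. clamp_abs (real n) (b (snd z)) \<partial>\<pi>)"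
      by (subst integral_distr) auto
    finally have 2: "(\<integral>w. clamp_abs (real n) (b (Q w)) \<partial>R)
        = (\<integral>z. clamp_abs (real n) (b (snd z)) \<partial>\<pi>)" .
    show "ennreal (\<integral>w. g n w \<partial>R) = ennreal (\<integral>z. k n z \<partial>\<pi>)"
      using 1 2 bounded by (simp add: g_def k_def)
  qed
  have g_nonneg: "0 \<le> g n w" if "w \<in> space R" for n w
    using that c_nonneg[of "P w" "Q w"] eq[OF that] P(2) Q(2) unfolding g_def
    by (intro clamp_abs_sum_nonneg) auto
  have g_le: "(\<integral>\<^sup>+w. ennreal (g n w) \<partial>R) \<le> (\<integral>\<^sup>+z. ennreal (c z) \<partial>\<pi>)" for n
  proof -
    have "(\<integral>\<^sup>+w. ennreal (g n w) \<partial>R) = ennreal (\<integral>w. g n w \<partial>R)"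
      by (intro nn_integral_eq_integral g_int AE_I2 g_nonneg)
    also have "\<dots> \<le> (\<integral>\<^sup>+z. ennreal (k n z) \<partial>\<pi>)"
      unfolding g_eq_k by (rule ennreal_integral_le_nn_integral[OF k_int])
    also have "\<dots> \<le> (\<integral>\<^sup>+z. ennreal (c z) \<partial>\<pi>)"
    proof (intro nn_integral_mono_AE)
      show "AE z in \<pi>. ennreal (k n z) \<le> ennreal (c z)"
        using AE_AB
      proof eventually_elim
        case (elim z)
        have "k n z \<le> max 0 (a (fst z) + b (snd z))"
          unfolding k_def by (intro clamp_abs_sum_le) auto
        also have "\<dots> \<le> c z"
          using le[of "fst z" "snd z"] c_nonneg[of "fst z" "snd z"] elim by simp
        finally show ?case by (rule ennreal_leI)
      qed
    qed
    finally show ?thesis .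
  qed
  have "(\<integral>\<^sup>+w. ennreal (c (P w, Q w)) \<partial>R) = (\<integral>\<^sup>+w. liminf (\<lambda>n. ennreal (g n w)) \<partial>R)"
  proof (intro nn_integral_cong)
    fix w assume w: "w \<in> space R"
    have "(\<lambda>n. ennreal (g n w)) \<longlonglongrightarrow> ennreal (a (P w) + b (Q w))"
      unfolding g_def by (intro tendsto_ennrealI tendsto_add clamp_abs_tendsto)
    then show "ennreal (c (P w, Q w)) = liminf (\<lambda>n. ennreal (g n w))"
      using eq[OF w] by (simp add: lim_imp_Liminf)
  qed
  also have "\<dots> \<le> liminf (\<lambda>n. \<integral>\<^sup>+w. ennreal (g n w) \<partial>R)"
    by (intro nn_integral_liminf) (simp add: g_def[abs_def])
  also have "\<dots> \<le> liminf (\<lambda>n. \<integral>\<^sup>+z. ennreal (c z) \<partial>\<pi>)"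
    by (intro Liminf_mono always_eventually allI g_le)
  finally show ?thesis by (simp add: Liminf_const)
qed

section \<open>The extended integral\<close>

lemma ext_integral_nonneg:
  assumes "\<And>x. x \<in> space N \<Longrightarrow> 0 \<le> f x"
  shows "ext_integral N f = enn2ereal (\<integral>\<^sup>+x. ennreal (f x) \<partial>N)"
proof -
  have "(\<integral>\<^sup>+x. ennreal (- f x) \<partial>N) = (\<integral>\<^sup>+x. 0 \<partial>N)"
    using assms by (intro nn_integral_cong) (auto simp: ennreal_neg)
  then show ?thesis
    by (simp add: ext_integral_def zero_ennreal.rep_eq)
qed

lemma ext_integral_cong:
  "(\<And>x. x \<in> space N \<Longrightarrow> f x = g x) \<Longrightarrow> ext_integral N f = ext_integral N g"
  unfolding ext_integral_def by (simp cong: nn_integral_cong)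

lemma ext_integral_cmult:
  assumes "0 \<le> c" and [measurable]: "f \<in> borel_measurable N"
  shows "ext_integral N (\<lambda>x. c * f x) = ereal c * ext_integral N f"
proof -
  have 1: "(\<integral>\<^sup>+x. ennreal (c * g x) \<partial>N) = ennreal c * (\<integral>\<^sup>+x. ennreal (g x) \<partial>N)"
    if [measurable]: "g \<in> borel_measurable N" for g
    using assms(1) by (simp add: ennreal_mult' nn_integral_cmult)
  have 2: "(\<integral>\<^sup>+x. ennreal (- (c * f x)) \<partial>N) = ennreal c * (\<integral>\<^sup>+x. ennreal (- f x) \<partial>N)"
    using 1[of "\<lambda>x. - f x"] by simp
  show ?thesis
    unfolding ext_integral_def 2 1[OF assms(2)] times_ennreal.rep_eq enn2ereal_ennreal[OF assms(1)]
    using assms(1)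
    by (cases "enn2ereal (\<integral>\<^sup>+x. ennreal (f x) \<partial>N)"; cases "enn2ereal (\<integral>\<^sup>+x. ennreal (- f x) \<partial>N)")
      (auto simp: algebra_simps)
qed

text \<open>Integrating \<open>f + (f - g)\<^sup>- = g + (f - g)\<^sup>+\<close> avoids \<open>\<infinity> - \<infinity>\<close>, and \<open>(f - g)\<^sup>+ \<le> f\<close> and
\<open>(f - g)\<^sup>- \<le> g\<close> show that the integrals of the two parts are not both infinite.\<close>

lemma ext_integral_diff_nonneg:
  assumes [measurable]: "f \<in> borel_measurable N" "g \<in> borel_measurable N"
    and "\<And>x. x \<in> space N \<Longrightarrow> 0 \<le> f x" "\<And>x. x \<in> space N \<Longrightarrow> 0 \<le> g x"
    and fin: "(\<integral>\<^sup>+x. ennreal (f x) \<partial>N) < \<infinity> \<or> (\<integral>\<^sup>+x. ennreal (g x) \<partial>N) < \<infinity>"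
  shows "ext_integral N (\<lambda>x. f x - g x) =
    enn2ereal (\<integral>\<^sup>+x. ennreal (f x) \<partial>N) - enn2ereal (\<integral>\<^sup>+x. ennreal (g x) \<partial>N)"
proof -
  define F G p m where "F = (\<integral>\<^sup>+x. ennreal (f x) \<partial>N)" and "G = (\<integral>\<^sup>+x. ennreal (g x) \<partial>N)"
    and "p = (\<integral>\<^sup>+x. ennreal (f x - g x) \<partial>N)" and "m = (\<integral>\<^sup>+x. ennreal (- (f x - g x)) \<partial>N)"
  have "F + m = (\<integral>\<^sup>+x. ennreal (f x) + ennreal (- (f x - g x)) \<partial>N)"
    unfolding F_def m_def by (intro nn_integral_add[symmetric]) auto
  also have "\<dots> = (\<integral>\<^sup>+x. ennreal (g x) + ennreal (f x - g x) \<partial>N)"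
  proof (intro nn_integral_cong)
    fix x assume "x \<in> space N"
    with assms(3,4)[of x] show "ennreal (f x) + ennreal (- (f x - g x)) = ennreal (g x) + ennreal (f x - g x)"
      by (cases "f x \<le> g x") (simp_all add: ennreal_neg flip: ennreal_plus)
  qed
  also have "\<dots> = G + p"
    unfolding G_def p_def by (intro nn_integral_add) auto
  finally have sum: "F + m = G + p" .
  have "p \<le> F"
    unfolding F_def p_def using assms(4) by (intro nn_integral_mono ennreal_leI) simp
  moreover have "m \<le> G"
    unfolding G_def m_def using assms(3) by (intro nn_integral_mono ennreal_leI) simp
  moreover have "F < \<infinity> \<or> G < \<infinity>"
    using fin by (simp add: F_def G_def)
  ultimately have "enn2ereal p - enn2ereal m = enn2ereal F - enn2ereal G"
    using sum
    by (cases F; cases G; cases p; cases m)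
      (auto simp: top_unique simp flip: ennreal_plus)
  then show ?thesis
    by (simp add: ext_integral_def F_def G_def p_def m_def)
qed

section \<open>Monotone pairs of maps in dimension one\<close>

text \<open>An open connected set of reals is the set of reals between its extended infimum and supremum.\<close>

lemma antiderivative_open_interval:
  fixes g :: "real \<Rightarrow> real"
  assumes "open I" "connected I" "continuous_on I g"
  obtains F where "\<And>s. s \<in> I \<Longrightarrow> (F has_real_derivative g s) (at s)"
proof (cases "I = {}")
  case False
  define a b where "a = (INF s\<in>I. ereal s)" and "b = (SUP s\<in>I. ereal s)"
  have ab: "a < ereal s" "ereal s < b" if s: "s \<in> I" for s
  proof -
    obtain e where e: "0 < e" "cball s e \<subseteq> I"
      using assms(1) s open_contains_cball by metis
    then have "s - e \<in> I" "s + e \<in> I"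
      by (auto simp: subset_iff dist_real_def)
    then have "a \<le> ereal (s - e)" "ereal (s + e) \<le> b"
      unfolding a_def b_def by (auto intro: INF_lower SUP_upper)
    moreover have "ereal (s - e) < ereal s" "ereal s < ereal (s + e)"
      using e by simp_all
    ultimately show "a < ereal s" "ereal s < b"
      by (meson order.strict_trans1 order.strict_trans2)+
  qed
  have I: "s \<in> I" if s: "a < ereal s" "ereal s < b" for s
  proof -
    obtain x where "x \<in> I" "x < s"
      using s(1) unfolding a_def INF_less_iff by auto
    moreover obtain y where "y \<in> I" "s < y"
      using s(2) unfolding b_def less_SUP_iff by auto
    ultimately
    show ?thesis
      using connected_contains_Icc[OF assms(2), of x y] by auto
  qed
  have "a < b" using False ab by (meson equals0I less_trans)
  then have "\<exists>F. \<forall>s::real. a < s \<longrightarrow> s < b \<longrightarrow> (F has_vector_derivative g s) (at s)"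
    using assms(1,3) I by (intro einterval_antiderivative) (simp_all add: continuous_on_eq_continuous_at)
  then obtain F where "\<And>s::real. a < s \<Longrightarrow> s < b \<Longrightarrow> (F has_vector_derivative g s) (at s)"
    by blast
  then show ?thesis
    using ab by (intro that[of F]) (simp add: has_real_derivative_iff_has_vector_derivative)
qed (use that in auto)

lemma monotone_derivative_tangent:
  fixes F :: "real \<Rightarrow> real"
  assumes "connected I" and F: "\<And>s. s \<in> I \<Longrightarrow> (F has_real_derivative g s) (at s)"
    and mono: "\<And>s r. s \<in> I \<Longrightarrow> r \<in> I \<Longrightarrow> s \<le> r \<Longrightarrow> g s \<le> g r"
    and s: "s \<in> I" and r: "r \<in> I"
  shows "F r + g r * (s - r) \<le> F s"
proof (cases s r rule: linorder_cases)
  case less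
  then have sub: "{s..r} \<subseteq> I" using assms by (intro connected_contains_Icc)
  obtain z where z: "s < z" "z < r" "F r - F s = (r - s) * g z"
    using MVT2[OF less, of F g] F sub by (auto simp: subset_iff)
  then have "z \<in> I" using sub by auto
  then have "(r - s) * g z \<le> (r - s) * g r"
    using z mono[of z r] r by (intro mult_left_mono) auto
  then show ?thesis using z by (simp add: algebra_simps)
next
  case greater
  then have sub: "{r..s} \<subseteq> I" using assms by (intro connected_contains_Icc)
  obtain z where z: "r < z" "z < s" "F s - F r = (s - r) * g z"
    using MVT2[OF greater, of F g] F sub by (auto simp: subset_iff)
  then have "z \<in> I" using sub by auto
  then have "(s - r) * g r \<le> (s - r) * g z"
    using z mono[of r z] r by (intro mult_left_mono) auto
  then show ?thesis using z by (simp add: algebra_simps)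
qed simp

text \<open>Monotonicity of the pair means that \<open>T\<close> is a nondecreasing function \<open>g\<close> of \<open>U\<close>. An antiderivative
of \<open>g\<close> on the open interval \<open>U ` X\<close> is convex, and its tangent inequality, pulled back along \<open>U\<close>, is the
claim.\<close>

lemma monotone_pair_potential_dim_1:
  fixes U T :: "real^'n \<Rightarrow> real^'n"
  assumes dim: "CARD('n) = 1" and X: "open X" "connected X"
    and U: "continuous_on X U" "inj_on U X" and T: "continuous_on X T"
    and mono: "\<And>x y. x \<in> X \<Longrightarrow> y \<in> X \<Longrightarrow> 0 \<le> (U x - U y) \<bullet> (T x - T y)"
  obtains \<psi> where "continuous_on X \<psi>"
    "\<And>x y. x \<in> X \<Longrightarrow> y \<in> X \<Longrightarrow> \<psi> y + T y \<bullet> (U x - U y) \<le> \<psi> x"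
proof -
  obtain i :: 'n where i: "UNIV = {i}"
    using dim by (auto simp: card_1_singleton_iff)
  have inner_i: "x \<bullet> y = x $ i * y $ i" for x y :: "real^'n"
    by (simp add: inner_vec_def i)
  have vec_i: "vec (x $ i) = x" for x :: "real^'n"
    using i by (auto simp: vec_eq_iff)
  define I where "I = (\<lambda>x. U x $ i) ` X"
  define g where "g s = T (inv_into X U (vec s)) $ i" for s
  have g: "g (U x $ i) = T x $ i" if "x \<in> X" for x
    using that by (simp add: g_def vec_i inv_into_f_f[OF U(2)])
  have Ui: "continuous_on X (\<lambda>x. U x $ i)"
    using U(1) by (rule continuous_on_component)
  have "open (U ` X)"
    by (rule invariance_of_domain[OF U(1) X(1) U(2)])
  have cvec: "continuous_on A (vec :: real \<Rightarrow> real^'n)" for A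
    by (intro linear_continuous_on) (simp add: linear_conv_bounded_linear[symmetric] linear_iff vec_eq_iff)
  have I_eq: "I = vec -` (U ` X)"
  proof (intro set_eqI iffI)
    fix s assume "s \<in> I"
    then show "s \<in> vec -` (U ` X)" by (auto simp: I_def vec_i)
  next
    fix s :: real assume "s \<in> vec -` (U ` X)"
    then obtain x where "x \<in> X" "vec s = U x" by auto
    then have "s = U x $ i" by (metis vec_component)
    then show "s \<in> I" using \<open>x \<in> X\<close> by (simp add: I_def)
  qed
  then have "open I"
    using open_vimage[OF \<open>open (U ` X)\<close> cvec] by simp
  have "connected I"
    unfolding I_def by (rule connected_continuous_image[OF Ui X(2)])
  have "continuous_on (U ` X) (\<lambda>u. T (inv_into X U u))"
  proof (rule continuous_on_compose2[OF T])
    show "continuous_on (U ` X) (inv_into X U)"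
      by (rule continuous_on_inverse_open[OF X(1) U(1)]) (simp_all add: inv_into_f_f[OF U(2)])
  qed (auto intro: inv_into_into)
  then have "continuous_on I (\<lambda>s. T (inv_into X U (vec s)))"
    by (rule continuous_on_compose2[OF _ cvec]) (auto simp: I_eq)
  then have "continuous_on I g"
    unfolding g_def[abs_def] by (rule continuous_on_component)
  then obtain F where F: "\<And>s. s \<in> I \<Longrightarrow> (F has_real_derivative g s) (at s)"
    using antiderivative_open_interval[OF \<open>open I\<close> \<open>connected I\<close>] by blast
  have g_mono: "g s \<le> g r" if sr: "s \<in> I" "r \<in> I" "s \<le> r" for s r
  proof (cases "s = r")
    case False
    obtain x y where x: "x \<in> X" "s = U x $ i" "y \<in> X" "r = U y $ i"
      using sr by (auto simp: I_def)
    then have "0 \<le> (r - s) * (g r - g s)"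
      using mono[of y x] by (simp add: inner_i g)
    then show ?thesis
      using sr False by (simp add: zero_le_mult_iff)
  qed simp
  show ?thesis
  proof (rule that[of "\<lambda>x. F (U x $ i)"])
    have "continuous_on I F"
      by (intro continuous_at_imp_continuous_on ballI DERIV_isCont[OF F])
    then show "continuous_on X (\<lambda>x. F (U x $ i))"
      by (rule continuous_on_compose2[OF _ Ui]) (auto simp: I_def)
    fix x y assume x: "x \<in> X" "y \<in> X"
    then have "F (U y $ i) + g (U y $ i) * (U x $ i - U y $ i) \<le> F (U x $ i)"
      by (intro monotone_derivative_tangent[OF \<open>connected I\<close> F g_mono]) (auto simp: I_def)
    then show "F (U y $ i) + T y \<bullet> (U x - U y) \<le> F (U x $ i)"
      using x by (simp add: inner_i g)
  qed
qed

section \<open>Bregman geometry\<close>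

locale bregman_space =
  fixes M :: "'m topology" and \<iota> :: "'m \<Rightarrow> real^'n"
    and X :: "(real^'n) set" and \<Omega> :: "real^'n \<Rightarrow> real"
  assumes manifold: "bregman_manifold M \<iota> X \<Omega>"
begin

abbreviation S :: "real^'n \<Rightarrow> real^'n" where "S \<equiv> egrad \<Omega>"
abbreviation Y :: "(real^'n) set" where "Y \<equiv> dual_domain X \<Omega>"
abbreviation \<Omega>' :: "real^'n \<Rightarrow> real" where "\<Omega>' \<equiv> dual_generator X \<Omega>"

lemma generator: "regular_bregman_generator X \<Omega>"
  using manifold by (simp add: bregman_manifold_def)

lemma open_X: "open X" and convex_X: "convex X" and smooth_\<Omega>: "smooth_on X \<Omega>"
  and convex_\<Omega>: "convex_on X \<Omega>" and convex_Y: "convex Y"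
  and posdef: "x \<in> X \<Longrightarrow> positive_definite (hessian \<Omega> x)"
  using generator by (auto simp: regular_bregman_generator_def)

lemma GDERIV_\<Omega>: "x \<in> X \<Longrightarrow> GDERIV \<Omega> x :> S x"
  using smooth_\<Omega>[unfolded smooth_on_def, rule_format, of "Suc 0"] by (intro GDERIV_egrad) simp

lemma S_has_derivative: "x \<in> X \<Longrightarrow> (S has_derivative (*v) (hessian \<Omega> x)) (at x)"
  using egrad_differentiable[OF open_X smooth_\<Omega>] unfolding hessian_def jacobian_works by simp

lemma continuous_on_\<Omega>: "continuous_on X \<Omega>"
  by (intro continuous_at_imp_continuous_on ballI
      has_derivative_continuous[OF GDERIV_\<Omega>[unfolded gderiv_def]])

lemma continuous_on_S: "continuous_on X S"
  by (intro continuous_at_imp_continuous_on ballI has_derivative_continuous[OF S_has_derivative])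

text \<open>Along a segment in direction \<open>v\<close> the derivative of \<open>S \<bullet> v\<close> is \<open>v \<bullet> H v > 0\<close>.\<close>

lemma S_strict_mono:
  assumes "x \<in> X" "x' \<in> X" "x \<noteq> x'"
  shows "0 < (S x - S x') \<bullet> (x - x')"
proof -
  define v where "v = x - x'"
  define g where "g = (\<lambda>s::real. S (x' + s *\<^sub>R v) \<bullet> v)"
  have "g 0 < g 1"
  proof (rule DERIV_pos_imp_increasing[of 0 1 g])
    fix s :: real assume s: "0 \<le> s" "s \<le> 1"
    have seg: "x' + s *\<^sub>R v \<in> X"
      using convexD_alt[OF convex_X assms(2,1) s] by (simp add: v_def algebra_simps)
    let ?H = "hessian \<Omega> (x' + s *\<^sub>R v)"
    have "((\<lambda>s. x' + s *\<^sub>R v) has_derivative (\<lambda>s. s *\<^sub>R v)) (at s)"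
      by (auto intro!: derivative_eq_intros)
    then have "((\<lambda>s. S (x' + s *\<^sub>R v)) has_derivative (\<lambda>s. ?H *v (s *\<^sub>R v))) (at s)"
      using S_has_derivative[OF seg]
      by (rule has_derivative_compose[where g = S and f = "\<lambda>s. x' + s *\<^sub>R v"])
    then have "(g has_derivative (\<lambda>s. (?H *v (s *\<^sub>R v)) \<bullet> v)) (at s)"
      unfolding g_def by (rule has_derivative_inner_left)
    moreover have "(\<lambda>s. (?H *v (s *\<^sub>R v)) \<bullet> v) = (*) (v \<bullet> (?H *v v))"
      by (auto simp: matrix_vector_mult_scaleR inner_commute)
    ultimately have "(g has_real_derivative v \<bullet> (?H *v v)) (at s)"
      by (simp add: has_field_derivative_def)
    moreover have "0 < v \<bullet> (?H *v v)"
      using posdef[OF seg] assms(3) by (simp add: positive_definite_def v_def)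
    ultimately show "\<exists>y. (g has_real_derivative y) (at s) \<and> 0 < y" by blast
  qed simp
  then show ?thesis
    by (simp add: g_def v_def algebra_simps)
qed

lemma inj_on_S: "inj_on S X"
proof (rule inj_onI, rule ccontr)
  fix x x' assume "x \<in> X" "x' \<in> X" "S x = S x'" "x \<noteq> x'"
  then show False using S_strict_mono[of x x'] by simp
qed

lemma open_Y: "open Y"
  unfolding dual_domain_def by (intro invariance_of_domain continuous_on_S open_X inj_on_S)

definition S_inv :: "real^'n \<Rightarrow> real^'n" where "S_inv = inv_into X S"

lemma S_inv_S [simp]: "x \<in> X \<Longrightarrow> S_inv (S x) = x"
  by (simp add: S_inv_def inv_into_f_f[OF inj_on_S])

lemma S_S_inv [simp]: "y \<in> Y \<Longrightarrow> S (S_inv y) = y"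
  by (simp add: S_inv_def dual_domain_def f_inv_into_f)

lemma S_inv_in_X [simp]: "y \<in> Y \<Longrightarrow> S_inv y \<in> X"
  by (simp add: S_inv_def dual_domain_def inv_into_into)

lemma S_in_Y [simp]: "x \<in> X \<Longrightarrow> S x \<in> Y"
  by (simp add: dual_domain_def)

lemma continuous_on_S_inv: "continuous_on Y S_inv"
  unfolding dual_domain_def
  by (rule continuous_on_inverse_open[OF open_X continuous_on_S]) auto

lemma \<Omega>'_S: "x \<in> X \<Longrightarrow> \<Omega>' (S x) = x \<bullet> S x - \<Omega> x"
  by (simp add: dual_generator_def inv_into_f_f[OF inj_on_S])

lemma continuous_on_\<Omega>'_S: "continuous_on X (\<lambda>x. \<Omega>' (S x))"
proof (rule continuous_on_eq)
  show "continuous_on X (\<lambda>x. x \<bullet> S x - \<Omega> x)"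
    by (intro continuous_on_diff continuous_on_inner continuous_on_id continuous_on_S
        continuous_on_\<Omega>)
qed (simp add: \<Omega>'_S)

lemma \<Omega>_gradient_inequality: "x \<in> X \<Longrightarrow> x' \<in> X \<Longrightarrow> \<Omega> x + S x \<bullet> (x' - x) \<le> \<Omega> x'"
  by (rule convex_on_gradient_inequality[OF convex_\<Omega> GDERIV_\<Omega>])

text \<open>Young's equality at \<open>x\<close> and \<open>x'\<close> turns this into the gradient inequality of \<open>\<Omega>\<close> at \<open>x'\<close>.\<close>

lemma \<Omega>'_gradient_inequality:
  assumes "x \<in> X" "x' \<in> X"
  shows "\<Omega>' (S x) + x \<bullet> (S x' - S x) \<le> \<Omega>' (S x')"
  using \<Omega>_gradient_inequality[OF assms(2,1)] assms by (simp add: \<Omega>'_S inner_diff_left inner_diff_right inner_commute)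

text \<open>For \<open>y = S z\<close> the remainder of the linear approximation at \<open>S x\<close> lies between \<open>0\<close> and
\<open>(z - x) \<bullet> (y - S x)\<close> by the gradient inequality at \<open>x\<close> and at \<open>z\<close>. It is \<open>o(\<bar>y - S x\<bar>)\<close> because \<open>z\<close>
tends to \<open>x\<close> as \<open>y\<close> tends to \<open>S x\<close>, by continuity of \<open>S_inv\<close>.\<close>

lemma GDERIV_\<Omega>':
  assumes x: "x \<in> X"
  shows "GDERIV \<Omega>' (S x) :> x"
  unfolding gderiv_def has_derivative_at2
proof (intro conjI)
  show "bounded_linear (\<lambda>h. h \<bullet> x)" by (rule bounded_linear_inner_left)
  let ?q = "\<lambda>y. (1 / norm (y - S x)) *\<^sub>R (\<Omega>' y - (\<Omega>' (S x) + (y - S x) \<bullet> x))"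
  have "isCont S_inv (S x)"
    using continuous_on_S_inv S_in_Y[OF x] by (simp add: continuous_on_eq_continuous_at[OF open_Y])
  then have "(S_inv \<longlongrightarrow> x) (at (S x))"
    using x by (simp add: isCont_def)
  then have lim: "((\<lambda>y. norm (S_inv y - x)) \<longlongrightarrow> 0) (at (S x))"
    by (intro tendsto_norm_zero LIM_zero)
  have "eventually (\<lambda>y. y \<in> Y) (at (S x))"
    using open_Y S_in_Y[OF x] by (rule eventually_at_in_open')
  then have "eventually (\<lambda>y. norm (?q y) \<le> norm (S_inv y - x)) (at (S x))"
  proof eventually_elim
    case (elim y)
    define z where "z = S_inv y"
    have z: "z \<in> X" "y = S z" using elim by (auto simp: z_def)
    let ?r = "\<Omega>' y - (\<Omega>' (S x) + (y - S x) \<bullet> x)"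
    have "0 \<le> ?r"
      using \<Omega>'_gradient_inequality[OF x z(1)] z(2) by (simp add: inner_commute)
    moreover have "?r \<le> (z - x) \<bullet> (y - S x)"
      using \<Omega>'_gradient_inequality[OF z(1) x] z(2)
      by (simp add: inner_diff_left inner_diff_right inner_commute)
    moreover have "(z - x) \<bullet> (y - S x) \<le> norm (z - x) * norm (y - S x)"
      by (rule norm_cauchy_schwarz)
    ultimately have "\<bar>?r\<bar> \<le> norm (z - x) * norm (y - S x)" by simp
    then show "norm (?q y) \<le> norm (S_inv y - x)"
      by (cases "y = S x") (auto simp: z_def divide_le_eq)
  qed
  then show "(?q \<longlongrightarrow> 0) (at (S x))"
    by (rule Lim_null_comparison[OF _ lim])
qed

lemma egrad_\<Omega>' [simp]: "x \<in> X \<Longrightarrow> egrad \<Omega>' (S x) = x"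
  by (rule egrad_eqI[OF GDERIV_\<Omega>'])

section \<open>The manifold as a measurable space\<close>

definition \<kappa> :: "real^'n \<Rightarrow> 'm" where "\<kappa> = inv_into (topspace M) \<iota>"

definition borel_M :: "'m measure" where "borel_M = sigma (topspace M) {U. openin M U}"

lemma homeo: "homeomorphic_map M (top_of_set X) \<iota>"
  using manifold by (simp add: bregman_manifold_def)

lemma inj_on_\<iota>: "inj_on \<iota> (topspace M)"
  and \<iota>_image: "\<iota> ` topspace M = X"
  and \<iota>_continuous: "continuous_map M (top_of_set X) \<iota>"
  and \<iota>_open: "open_map M (top_of_set X) \<iota>"
  using homeo by (auto simp: homeomorphic_eq_everything_map)

lemma \<iota>_in_X [simp]: "p \<in> topspace M \<Longrightarrow> \<iota> p \<in> X"
  using \<iota>_image by blast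

lemma \<kappa>_\<iota> [simp]: "p \<in> topspace M \<Longrightarrow> \<kappa> (\<iota> p) = p"
  by (simp add: \<kappa>_def inv_into_f_f[OF inj_on_\<iota>])

lemma \<iota>_\<kappa> [simp]: "x \<in> X \<Longrightarrow> \<iota> (\<kappa> x) = x"
  using \<iota>_image by (metis \<kappa>_def f_inv_into_f)

lemma \<kappa>_in_M [simp]: "x \<in> X \<Longrightarrow> \<kappa> x \<in> topspace M"
  using \<iota>_image by (metis \<kappa>_def inv_into_into)

lemma space_borel_M [simp]: "space borel_M = topspace M"
  unfolding borel_M_def by (rule space_measure_of) (auto dest: openin_subset)

lemma sets_borel_M: "sets borel_M = sigma_sets (topspace M) {U. openin M U}"
  unfolding borel_M_def by (rule sets_measure_of) (auto dest: openin_subset)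

lemma openin_sets_borel_M: "openin M U \<Longrightarrow> U \<in> sets borel_M"
  by (simp add: sets_borel_M sigma_sets.Basic)

lemma measurable_\<iota>: "\<iota> \<in> measurable borel_M (restrict_space borel X)"
proof (rule measurable_restrict_space2)
  show "\<iota> \<in> space borel_M \<rightarrow> X" by simp
  show "\<iota> \<in> measurable borel_M borel"
  proof (rule borel_measurableI)
    fix U :: "(real^'n) set" assume "open U"
    then have "openin (top_of_set X) (X \<inter> U)" by (simp add: openin_open_Int)
    then have "openin M {p \<in> topspace M. \<iota> p \<in> X \<inter> U}"
      using \<iota>_continuous by (rule openin_continuous_map_preimage[rotated])
    moreover have "{p \<in> topspace M. \<iota> p \<in> X \<inter> U} = \<iota> -` U \<inter> space borel_M" by auto
    ultimately show "\<iota> -` U \<inter> space borel_M \<in> sets borel_M"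
      by (simp add: openin_sets_borel_M)
  qed
qed

lemma measurable_\<kappa>: "\<kappa> \<in> measurable (restrict_space borel X) borel_M"
  unfolding borel_M_def
proof (rule measurable_measure_of)
  show "{U. openin M U} \<subseteq> Pow (topspace M)" by (auto dest: openin_subset)
  show "\<kappa> \<in> space (restrict_space borel X) \<rightarrow> topspace M" by (auto simp: space_restrict_space)
  fix U assume "U \<in> {U. openin M U}"
  then have U: "openin M U" by simp
  have "openin (top_of_set X) (\<iota> ` U)"
    using \<iota>_open U by (auto simp: open_map_def)
  then have "open (\<iota> ` U)" "\<iota> ` U \<subseteq> X"
    using open_X by (auto simp: openin_open_eq)
  moreover have "\<kappa> -` U \<inter> space (restrict_space borel X) = \<iota> ` U"
    using openin_subset[OF U] \<iota>_\<kappa> by (force simp: space_restrict_space)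
  ultimately show "\<kappa> -` U \<inter> space (restrict_space borel X) \<in> sets (restrict_space borel X)"
    by (auto simp: sets_restrict_space_iff open_X)
qed

lemma borel_probsD:
  assumes "\<mu> \<in> borel_probs M"
  shows "prob_space \<mu>" "sets \<mu> = sets borel_M" "space \<mu> = topspace M"
  using assms sets_eq_imp_space_eq[of \<mu> borel_M]
  by (auto simp: borel_probs_def borel_M_def[symmetric])

lemma measurable_chart_continuous:
  fixes g :: "real^'n \<Rightarrow> 'c::topological_space"
  assumes "continuous_on X g"
  shows "(\<lambda>p. g (\<iota> p)) \<in> borel_measurable borel_M"
  using measurable_compose[OF measurable_\<iota> borel_measurable_continuous_on_restrict[OF assms]] .

definition lift :: "(real^'n \<Rightarrow> real^'n) \<Rightarrow> 'm \<Rightarrow> 'm" where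
  "lift V p = \<kappa> (V (\<iota> p))"

lemma measurable_lift:
  assumes "continuous_on X V" "V \<in> X \<rightarrow> X"
  shows "lift V \<in> measurable borel_M borel_M"
proof -
  have "V \<in> measurable (restrict_space borel X) (restrict_space borel X)"
    using assms by (intro measurable_restrict_space2 borel_measurable_continuous_on_restrict)
      (auto simp: space_restrict_space)
  then have "(\<lambda>p. \<kappa> (V (\<iota> p))) \<in> measurable borel_M borel_M"
    by (intro measurable_compose[OF measurable_\<iota>] measurable_compose[OF _ measurable_\<kappa>])
  then show ?thesis by (simp add: lift_def[abs_def])
qed

lemma measurable_lift_probs:
  assumes "\<rho> \<in> borel_probs M" "continuous_on X V" "V \<in> X \<rightarrow> X"
  shows "lift V \<in> measurable \<rho> borel_M"
  using measurable_lift[OF assms(2,3)] unfolding measurable_cong_sets[OF borel_probsD(2)[OF assms(1)] refl] .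

lemma distr_lift_id:
  assumes \<rho>: "\<rho> \<in> borel_probs M"
  shows "distr \<rho> borel_M (lift id) = \<rho>"
proof -
  have "distr \<rho> borel_M (lift id) = distr \<rho> borel_M (\<lambda>p. p)"
    using borel_probsD[OF \<rho>] by (intro distr_cong) (simp_all add: lift_def)
  also have "\<dots> = \<rho>"
    using borel_probsD[OF \<rho>] by (intro distr_id2) simp
  finally show ?thesis .
qed

text \<open>A measure on the manifold is determined by its law in a coordinate \<open>g\<close> with a measurable left
inverse; \<open>g\<close> will be the primal chart for \<open>\<mu> t\<close> and the dual chart for \<open>\<nu> t\<close>.\<close>

lemma law_eq_distr_lift:
  assumes \<mu>: "\<mu> \<in> borel_probs M" and \<rho>: "\<rho> \<in> borel_probs M"
    and V: "continuous_on X V" "V \<in> X \<rightarrow> X"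
    and g: "g \<in> measurable borel_M N'"
      "g' \<in> measurable N' borel_M" "\<And>p. p \<in> topspace M \<Longrightarrow> g' (g p) = p"
    and law: "distr \<mu> N' g = distr \<rho> N' (\<lambda>p. g (lift V p))"
  shows "\<mu> = distr \<rho> borel_M (lift V)"
proof -
  note D = borel_probsD[OF \<mu>] borel_probsD[OF \<rho>]
  have gm: "g \<in> measurable \<mu> N'" using g(1) D by (simp cong: measurable_cong_sets)
  have lm: "lift V \<in> measurable \<rho> borel_M"
    by (rule measurable_lift_probs[OF \<rho> V])
  have "\<mu> = distr \<mu> borel_M (\<lambda>p. p)"
    using D by (intro distr_id2[symmetric]) simp
  also have "\<dots> = distr \<mu> borel_M (g' \<circ> g)"
    using g(3) D by (intro distr_cong) auto
  also have "\<dots> = distr (distr \<mu> N' g) borel_M g'"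
    using g(2) gm by (simp add: distr_distr)
  also have "\<dots> = distr \<rho> borel_M (g' \<circ> (\<lambda>p. g (lift V p)))"
    unfolding law using g(2) measurable_compose[OF lm g(1)] by (simp add: distr_distr)
  also have "\<dots> = distr \<rho> borel_M (lift V)"
    using g(3) D V(2) by (intro distr_cong) (auto simp: lift_def Pi_iff)
  finally show ?thesis .
qed

section \<open>Transport costs\<close>

abbreviation B :: "'m \<Rightarrow> 'm \<Rightarrow> real" where "B \<equiv> bregman_div \<iota> X \<Omega>"

lemma B_eq: "B p q = \<Omega> (\<iota> p) + \<Omega>' (S (\<iota> q)) - \<iota> p \<bullet> S (\<iota> q)"
  by (simp add: bregman_div_def dual_chart_def)

lemma B_nonneg: "p \<in> topspace M \<Longrightarrow> q \<in> topspace M \<Longrightarrow> 0 \<le> B p q"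
  using \<Omega>_gradient_inequality[of "\<iota> q" "\<iota> p"]
  by (simp add: B_eq \<Omega>'_S inner_diff_right inner_commute)

lemma measurable_B: "(\<lambda>z. B (fst z) (snd z)) \<in> borel_measurable (borel_M \<Otimes>\<^sub>M borel_M)"
proof -
  note [measurable] = measurable_chart_continuous[OF continuous_on_\<Omega>]
    measurable_chart_continuous[OF continuous_on_\<Omega>'_S]
    measurable_chart_continuous[OF continuous_on_S]
    measurable_chart_continuous[OF continuous_on_id]
  show ?thesis unfolding B_eq by measurable
qed

text \<open>The cost of the coupling of the images of \<open>\<rho>\<close> under \<open>lift V\<close> and \<open>lift W\<close> that is induced by \<open>\<rho>\<close>
itself.\<close>

definition transport_cost where
  "transport_cost \<rho> V W = (\<integral>\<^sup>+p. ennreal (B (lift V p) (lift W p)) \<partial>\<rho>)"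

lemma measurable_B_lift:
  assumes \<rho>: "\<rho> \<in> borel_probs M"
    and V: "continuous_on X V" "V \<in> X \<rightarrow> X" and W: "continuous_on X W" "W \<in> X \<rightarrow> X"
  shows "(\<lambda>p. B (lift V p) (lift W p)) \<in> borel_measurable \<rho>"
proof -
  have "(\<lambda>p. (lift V p, lift W p)) \<in> measurable borel_M (borel_M \<Otimes>\<^sub>M borel_M)"
    by (intro measurable_Pair measurable_lift V W)
  from measurable_compose[OF this measurable_B] show ?thesis
    using borel_probsD[OF \<rho>] by (simp cong: measurable_cong_sets)
qed

lemma lift_in_M: "V \<in> X \<rightarrow> X \<Longrightarrow> p \<in> topspace M \<Longrightarrow> lift V p \<in> topspace M"
  by (auto simp: lift_def Pi_iff)

lemma ext_integral_coupling:
  assumes "\<pi> \<in> couplings (distr \<rho> borel_M P) (distr \<rho> borel_M Q)"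
  shows "ext_integral \<pi> (\<lambda>(p, q). B p q) = enn2ereal (\<integral>\<^sup>+z. ennreal (B (fst z) (snd z)) \<partial>\<pi>)"
proof -
  have "sets \<pi> = sets (distr \<rho> borel_M P \<Otimes>\<^sub>M distr \<rho> borel_M Q)"
    using assms unfolding couplings_def by blast
  also have "\<dots> = sets (borel_M \<Otimes>\<^sub>M borel_M)"
    by (rule sets_pair_measure_cong) simp_all
  finally have "space \<pi> = space (borel_M \<Otimes>\<^sub>M borel_M)"
    by (rule sets_eq_imp_space_eq)
  then have "space \<pi> = topspace M \<times> topspace M"
    by (simp only: space_pair_measure space_borel_M)
  then have "0 \<le> B (fst z) (snd z)" if "z \<in> space \<pi>" for z
    using that by (simp add: B_nonneg mem_Times_iff)
  then have "ext_integral \<pi> (\<lambda>z. B (fst z) (snd z))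
      = enn2ereal (\<integral>\<^sup>+z. ennreal (B (fst z) (snd z)) \<partial>\<pi>)"
    by (rule ext_integral_nonneg)
  then show ?thesis
    by (simp only: case_prod_beta')
qed

lemma BW_div_le_transport_cost:
  assumes \<rho>: "\<rho> \<in> borel_probs M"
    and V: "continuous_on X V" "V \<in> X \<rightarrow> X" and W: "continuous_on X W" "W \<in> X \<rightarrow> X"
  shows "BW_div \<iota> X \<Omega> (distr \<rho> borel_M (lift V)) (distr \<rho> borel_M (lift W))
    \<le> enn2ereal (transport_cost \<rho> V W)"
proof -
  note D = borel_probsD[OF \<rho>]
  interpret prob_space \<rho> by (rule D)
  let ?\<pi> = "distr \<rho> (borel_M \<Otimes>\<^sub>M borel_M) (\<lambda>p. (lift V p, lift W p))"
  have Vm: "lift V \<in> measurable \<rho> borel_M" and Wm: "lift W \<in> measurable \<rho> borel_M"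
    by (rule measurable_lift_probs[OF \<rho> V] measurable_lift_probs[OF \<rho> W])+
  have VW: "(\<lambda>p. (lift V p, lift W p)) \<in> measurable \<rho> (borel_M \<Otimes>\<^sub>M borel_M)"
    by (intro measurable_Pair Vm Wm)
  have \<pi>: "?\<pi> \<in> couplings (distr \<rho> borel_M (lift V)) (distr \<rho> borel_M (lift W))"
    unfolding couplings_def
  proof (intro CollectI conjI)
    show "prob_space ?\<pi>" by (rule prob_space_distr[OF VW])
    show "sets ?\<pi> = sets (distr \<rho> borel_M (lift V) \<Otimes>\<^sub>M distr \<rho> borel_M (lift W))"
      unfolding sets_distr by (rule sets_pair_measure_cong) simp_all
    have fst: "fst \<in> measurable (borel_M \<Otimes>\<^sub>M borel_M) (distr \<rho> borel_M (lift V))"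
      and snd: "snd \<in> measurable (borel_M \<Otimes>\<^sub>M borel_M) (distr \<rho> borel_M (lift W))"
      by (simp_all only: measurable_distr_eq2 measurable_fst measurable_snd)
    show "distr ?\<pi> (distr \<rho> borel_M (lift V)) fst = distr \<rho> borel_M (lift V)"
      unfolding distr_distr[OF fst VW] by (intro distr_cong) simp_all
    show "distr ?\<pi> (distr \<rho> borel_M (lift W)) snd = distr \<rho> borel_M (lift W)"
      unfolding distr_distr[OF snd VW] by (intro distr_cong) simp_all
  qed
  have "BW_div \<iota> X \<Omega> (distr \<rho> borel_M (lift V)) (distr \<rho> borel_M (lift W))
      \<le> ext_integral ?\<pi> (\<lambda>(p, q). B p q)"
    unfolding BW_div_def by (rule INF_lower[OF \<pi>])
  also have "\<dots> = enn2ereal (transport_cost \<rho> V W)"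
  proof -
    have "(\<lambda>z. ennreal (B (fst z) (snd z))) \<in> borel_measurable ?\<pi>"
      using measurable_compose[OF measurable_B measurable_ennreal] by (simp only: measurable_distr_eq1)
    from nn_integral_distr[OF VW this] show ?thesis
      unfolding ext_integral_coupling[OF \<pi>] transport_cost_def by (simp only: fst_conv snd_conv)
  qed
  finally show ?thesis .
qed

text \<open>By invariance of domain, \<open>V ` X\<close> is open and \<open>V\<close> has a continuous inverse on it, so a continuous
potential in the parameter \<open>x\<close> becomes a Borel function of the point \<open>V x\<close>. It is
extended by zero to the complement of \<open>V ` X\<close>, a null set for the law of \<open>lift V\<close>.\<close>

lemma inj_image_measurable_inverse:
  assumes "continuous_on X V" "V \<in> X \<rightarrow> X" "inj_on V X" "continuous_on X (g :: real^'n \<Rightarrow> real)"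
  shows "\<kappa> ` V ` X \<in> sets borel_M"
    and "(\<lambda>p. indicator (V ` X) (\<iota> p) * g (inv_into X V (\<iota> p))) \<in> borel_measurable borel_M"
proof -
  have VX: "open (V ` X)" "V ` X \<subseteq> X"
    using invariance_of_domain[OF assms(1) open_X assms(3)] assms(2) by auto
  then have VXs: "V ` X \<in> sets borel" by simp
  have \<iota>m: "\<iota> \<in> borel_measurable borel_M"
    using measurable_chart_continuous[OF continuous_on_id] .
  have "\<iota> -` V ` X \<inter> space borel_M = \<kappa> ` V ` X"
  proof (intro set_eqI iffI)
    fix p assume "p \<in> \<iota> -` V ` X \<inter> space borel_M"
    then have "p = \<kappa> (\<iota> p)" "\<iota> p \<in> V ` X" by auto
    then show "p \<in> \<kappa> ` V ` X" by (rule image_eqI)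
  next
    fix p assume "p \<in> \<kappa> ` V ` X"
    then show "p \<in> \<iota> -` V ` X \<inter> space borel_M"
      using VX(2) by auto
  qed
  then show "\<kappa> ` V ` X \<in> sets borel_M"
    using measurable_sets[OF \<iota>m VXs] by simp
  have "continuous_on (V ` X) (inv_into X V)"
    by (rule continuous_on_inverse_open[OF open_X assms(1)]) (simp_all add: inv_into_f_f[OF assms(3)])
  then have "continuous_on (V ` X) (\<lambda>u. g (inv_into X V u))"
    by (rule continuous_on_compose2[OF assms(4)]) (auto intro: inv_into_into)
  from borel_measurable_continuous_on_indicator[OF VXs this]
  have "(\<lambda>u. indicator (V ` X) u * g (inv_into X V u)) \<in> borel_measurable borel"
    by simp
  from measurable_compose[OF \<iota>m this]
  show "(\<lambda>p. indicator (V ` X) (\<iota> p) * g (inv_into X V (\<iota> p))) \<in> borel_measurable borel_M" .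
qed

text \<open>In the cost \<open>\<Omega> u + \<Omega>\<^sup>* v - u \<bullet> v\<close> only the pairing depends on the coupling, so potentials
\<open>\<alpha>\<close>, \<open>\<beta>\<close> for the pairing yield the potentials \<open>\<Omega> - \<alpha>\<close> and \<open>\<Omega>\<^sup>* - \<beta>\<close> for the cost. They are
given as functions of the common parameter \<open>x\<close>, and \<open>V\<close> and \<open>W\<close> are inverted to make them functions
of the two points.\<close>

lemma BW_div_eq_transport_cost:
  assumes \<rho>: "\<rho> \<in> borel_probs M"
    and V: "continuous_on X V" "V \<in> X \<rightarrow> X" "inj_on V X"
    and W: "continuous_on X W" "W \<in> X \<rightarrow> X" "inj_on W X"
    and \<alpha>: "continuous_on X \<alpha>" and \<beta>: "continuous_on X \<beta>"
    and le: "\<And>x x'. x \<in> X \<Longrightarrow> x' \<in> X \<Longrightarrow> V x \<bullet> S (W x') \<le> \<alpha> x + \<beta> x'"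
    and eq: "\<And>x. x \<in> X \<Longrightarrow> V x \<bullet> S (W x) = \<alpha> x + \<beta> x"
  shows "BW_div \<iota> X \<Omega> (distr \<rho> borel_M (lift V)) (distr \<rho> borel_M (lift W))
    = enn2ereal (transport_cost \<rho> V W)"
proof (rule antisym[OF BW_div_le_transport_cost[OF \<rho> V(1,2) W(1,2)]])
  note D = borel_probsD[OF \<rho>]
  define a where "a p = \<Omega> (\<iota> p) - indicator (V ` X) (\<iota> p) * \<alpha> (inv_into X V (\<iota> p))" for p
  define b where "b p = \<Omega>' (S (\<iota> p)) - indicator (W ` X) (\<iota> p) * \<beta> (inv_into X W (\<iota> p))" for p
  have a: "a (\<kappa> (V x)) = \<Omega> (V x) - \<alpha> x" if "x \<in> X" for x
    using funcset_mem[OF V(2) that] that by (simp add: a_def inv_into_f_f[OF V(3)])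
  have b: "b (\<kappa> (W x)) = \<Omega>' (S (W x)) - \<beta> x" if "x \<in> X" for x
    using funcset_mem[OF W(2) that] that by (simp add: b_def inv_into_f_f[OF W(3)])
  note mV = inj_image_measurable_inverse[OF V \<alpha>] and mW = inj_image_measurable_inverse[OF W \<beta>]
  show "enn2ereal (transport_cost \<rho> V W)
      \<le> BW_div \<iota> X \<Omega> (distr \<rho> borel_M (lift V)) (distr \<rho> borel_M (lift W))"
    unfolding BW_div_def
  proof (rule INF_greatest)
    fix \<pi> assume \<pi>: "\<pi> \<in> couplings (distr \<rho> borel_M (lift V)) (distr \<rho> borel_M (lift W))"
    have "(\<integral>\<^sup>+p. ennreal ((\<lambda>z. B (fst z) (snd z)) (lift V p, lift W p)) \<partial>\<rho>)
        \<le> (\<integral>\<^sup>+z. ennreal (B (fst z) (snd z)) \<partial>\<pi>)"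
    proof (rule coupling_optimal_if_potentials[OF D(1), where a = a and b = b])
      show "lift V \<in> measurable \<rho> borel_M" "lift W \<in> measurable \<rho> borel_M"
        by (rule measurable_lift_probs[OF \<rho> V(1,2)] measurable_lift_probs[OF \<rho> W(1,2)])+
      show "lift V \<in> space \<rho> \<rightarrow> \<kappa> ` V ` X" "lift W \<in> space \<rho> \<rightarrow> \<kappa> ` W ` X"
        by (auto simp only: D(3) lift_def intro!: imageI \<iota>_in_X)
      show "\<kappa> ` V ` X \<in> sets borel_M" "\<kappa> ` W ` X \<in> sets borel_M"
        by (rule mV mW)+
      show "a \<in> borel_measurable borel_M"
        unfolding a_def[abs_def]
        by (rule borel_measurable_diff[OF measurable_chart_continuous[OF continuous_on_\<Omega>] mV(2)])
      show "b \<in> borel_measurable borel_M"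
        unfolding b_def[abs_def]
        by (rule borel_measurable_diff[OF measurable_chart_continuous[OF continuous_on_\<Omega>'_S] mW(2)])
      show "\<pi> \<in> couplings (distr \<rho> borel_M (lift V)) (distr \<rho> borel_M (lift W))" by (rule \<pi>)
    next
      fix u v assume "u \<in> \<kappa> ` V ` X" "v \<in> \<kappa> ` W ` X"
      then obtain x x' where x: "x \<in> X" "u = \<kappa> (V x)" "x' \<in> X" "v = \<kappa> (W x')" by auto
      then have VW: "V x \<in> X" "W x' \<in> X" using V W by auto
      show "0 \<le> B (fst (u, v)) (snd (u, v))"
        using x VW by (simp add: B_nonneg)
      show "a u + b v \<le> B (fst (u, v)) (snd (u, v))"
        using x VW le[of x x'] by (simp add: a b B_eq)
    next
      fix p assume "p \<in> space \<rho>"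
      then have p: "\<iota> p \<in> X" using D by simp
      then have "V (\<iota> p) \<in> X" "W (\<iota> p) \<in> X" using V W by auto
      then show "a (lift V p) + b (lift W p) = B (fst (lift V p, lift W p)) (snd (lift V p, lift W p))"
        using eq[OF p] by (simp add: lift_def a[OF p] b[OF p] B_eq)
    qed
    then show "enn2ereal (transport_cost \<rho> V W) \<le> ext_integral \<pi> (\<lambda>(p, q). B p q)"
      unfolding ext_integral_coupling[OF \<pi>] transport_cost_def less_eq_ennreal.rep_eq[symmetric]
      by simp
  qed
qed

section \<open>Otto's inner product in coordinates\<close>

lemma bregman_metric_eq_inner: "bregman_metric \<iota> \<Omega> p u v = u \<bullet> (hessian \<Omega> (\<iota> p) *v v)"
  by (simp add: bregman_metric_def inner_vec_def matrix_vector_mult_def sum_distrib_left mult_ac)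

lemma hessian_symmetric: "x \<in> X \<Longrightarrow> u \<bullet> (hessian \<Omega> x *v v) = (hessian \<Omega> x *v u) \<bullet> v"
  using posdef[of x] by (metis dot_lmul_matrix positive_definite_def transpose_matrix_vector)

lemma riemannian_grad_eqI:
  assumes p: "p \<in> topspace M"
    and u: "\<And>v. bregman_metric \<iota> \<Omega> p u v = mdifferential M \<iota> \<phi> p v"
  shows "riemannian_grad M \<iota> \<Omega> \<phi> p = u"
  unfolding riemannian_grad_def
proof (rule the_equality)
  show "\<forall>v. bregman_metric \<iota> \<Omega> p u v = mdifferential M \<iota> \<phi> p v" using u by simp
next
  fix w assume w: "\<forall>v. bregman_metric \<iota> \<Omega> p w v = mdifferential M \<iota> \<phi> p v"
  have "(w - u) \<bullet> (hessian \<Omega> (\<iota> p) *v v) = 0" for v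
    using u w by (simp add: bregman_metric_eq_inner inner_diff_left)
  then show "w = u"
    using posdef[OF \<iota>_in_X[OF p]] unfolding positive_definite_def
    by (metis eq_iff_diff_eq_0 less_irrefl)
qed

lemma hessian_surj: "x \<in> X \<Longrightarrow> \<exists>u. hessian \<Omega> x *v u = w"
proof -
  assume x: "x \<in> X"
  have "inj ((*v) (hessian \<Omega> x))"
  proof (subst linear_injective_0[OF matrix_vector_mul_linear], intro allI impI, rule ccontr)
    fix v assume "hessian \<Omega> x *v v = 0" "v \<noteq> 0"
    then show False using posdef[OF x] by (metis inner_zero_right less_irrefl positive_definite_def)
  qed
  then have "surj ((*v) (hessian \<Omega> x))"
    by (rule linear_inj_imp_surj[OF matrix_vector_mul_linear])
  then show ?thesis by (metis surjD)
qed

lemma mdifferential_eq: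
  assumes p: "p \<in> topspace M" and g: "(g has_derivative D) (at (\<iota> p))"
  shows "mdifferential M \<iota> (g \<circ> \<iota>) p v = D v"
proof -
  have "((g \<circ> \<iota>) \<circ> inv_into (topspace M) \<iota> has_derivative D) (at (\<iota> p))"
    using \<iota>_\<kappa> by (intro has_derivative_transform_within_open[OF g open_X \<iota>_in_X[OF p]])
      (simp add: \<kappa>_def)
  then show ?thesis
    unfolding mdifferential_def by (metis frechet_derivative_at)
qed

text \<open>By definition of the gradient, the metric of \<open>grad \<phi>\<close> and \<open>e\<close> is \<open>d\<phi> e\<close>. So it suffices to know that
the second gradient is \<open>e = Dh (S x) - x\<close>: the differential of \<open>(h - \<Omega>\<^sup>*) \<circ> S\<close> is \<open>v \<mapsto> H v \<bullet> e\<close>, in which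
\<open>H\<close> is exactly the metric. The first gradient \<open>u\<close> only has to exist, which is solvability of
\<open>H u = Df x - S x\<close>.\<close>

lemma otto_integrand_eq:
  assumes p: "p \<in> topspace M" and f: "f differentiable (at (\<iota> p))"
    and h: "h differentiable (at (S (\<iota> p)))"
  shows "bregman_metric \<iota> \<Omega> p
      (riemannian_grad M \<iota> \<Omega> ((\<lambda>x. f x - \<Omega> x) \<circ> \<iota>) p)
      (riemannian_grad M \<iota> \<Omega> ((\<lambda>y. h y - \<Omega>' y) \<circ> dual_chart \<iota> \<Omega>) p)
    = (egrad h (S (\<iota> p)) - \<iota> p) \<bullet> (egrad f (\<iota> p) - S (\<iota> p))"
proof -
  define x where "x = \<iota> p"
  have x: "x \<in> X" using p by (simp add: x_def)
  define d where "d = egrad f x - S x"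
  define e where "e = egrad h (S x) - x"
  have "GDERIV (\<lambda>x. f x - \<Omega> x) x :> d"
    unfolding d_def using f x by (intro GDERIV_diff GDERIV_egrad GDERIV_\<Omega>) (simp add: x_def)
  then have diff1: "mdifferential M \<iota> ((\<lambda>x. f x - \<Omega> x) \<circ> \<iota>) p v = v \<bullet> d" for v
    using mdifferential_eq[OF p] by (simp add: gderiv_def x_def)
  have "GDERIV (\<lambda>y. h y - \<Omega>' y) (S x) :> e"
    unfolding e_def using h x by (intro GDERIV_diff GDERIV_egrad GDERIV_\<Omega>') (simp_all add: x_def)
  then have "((\<lambda>z. h (S z) - \<Omega>' (S z)) has_derivative (\<lambda>v. (hessian \<Omega> x *v v) \<bullet> e)) (at x)"
    unfolding gderiv_def
    by (rule has_derivative_compose[OF S_has_derivative[OF x], where g = "\<lambda>y. h y - \<Omega>' y"])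
  then have diff2: "mdifferential M \<iota> ((\<lambda>y. h y - \<Omega>' y) \<circ> dual_chart \<iota> \<Omega>) p v
      = (hessian \<Omega> x *v v) \<bullet> e" for v
    using mdifferential_eq[OF p, where g = "\<lambda>z. h (S z) - \<Omega>' (S z)"]
    by (simp add: x_def dual_chart_def comp_def)
  obtain u where u: "hessian \<Omega> x *v u = d"
    using hessian_surj[OF x] by blast
  have "riemannian_grad M \<iota> \<Omega> ((\<lambda>x. f x - \<Omega> x) \<circ> \<iota>) p = u"
    using u hessian_symmetric[OF x]
    by (intro riemannian_grad_eqI[OF p]) (simp add: diff1 bregman_metric_eq_inner flip: x_def, simp add: inner_commute)
  moreover have "riemannian_grad M \<iota> \<Omega> ((\<lambda>y. h y - \<Omega>' y) \<circ> dual_chart \<iota> \<Omega>) p = e"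
    by (intro riemannian_grad_eqI[OF p]) (simp add: diff2 bregman_metric_eq_inner inner_commute flip: x_def)
  ultimately show ?thesis
    using hessian_symmetric[OF x, of u e] u
    by (simp add: bregman_metric_eq_inner inner_commute d_def e_def flip: x_def)
qed

end

section \<open>Displacement interpolations\<close>

lemma smooth_convex_gradientD:
  assumes "smooth_convex_gradient S T f"
  shows "convex_on S f" "continuous_on S (egrad f)" "x \<in> S \<Longrightarrow> egrad f x \<in> T"
    "x \<in> S \<Longrightarrow> f differentiable (at x)" "x \<in> S \<Longrightarrow> GDERIV f x :> egrad f x"
    "continuous_on S f"
proof -
  show *: "convex_on S f" "x \<in> S \<Longrightarrow> f differentiable (at x)" "x \<in> S \<Longrightarrow> egrad f x \<in> T" for x
    using assms by (auto simp: smooth_convex_gradient_def)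
  show "continuous_on S (egrad f)"
    using assms unfolding smooth_convex_gradient_def smooth_on_def by (metis Ck_on.simps(1))
  show "x \<in> S \<Longrightarrow> GDERIV f x :> egrad f x"
    by (intro GDERIV_egrad *)
  show "continuous_on S f"
    by (intro continuous_at_imp_continuous_on ballI differentiable_imp_continuous_within *)
qed

locale displacement = bregman_space M \<iota> X \<Omega>
  for M :: "'m topology" and \<iota> :: "'m \<Rightarrow> real^'n" and X \<Omega> +
  fixes f h :: "real^'n \<Rightarrow> real" and t :: real
  assumes f: "smooth_convex_gradient X (dual_domain X \<Omega>) f"
    and h: "smooth_convex_gradient (dual_domain X \<Omega>) X h"
    and t: "0 \<le> t" "t < 1"
begin

definition T where "T x = (1 - t) *\<^sub>R S x + t *\<^sub>R egrad f x"
definition U where "U x = (1 - t) *\<^sub>R x + t *\<^sub>R egrad h (S x)"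
text \<open>The map \<open>T\<close> takes values in dual coordinates; \<open>W\<close> expresses the same point in primal ones.\<close>

definition W where "W x = S_inv (T x)"

lemmas f_facts = smooth_convex_gradientD[OF f]
lemmas h_facts = smooth_convex_gradientD[OF h]

lemma T_in_Y: "x \<in> X \<Longrightarrow> T x \<in> Y"
  unfolding T_def using t by (intro convexD[OF convex_Y] f_facts S_in_Y) auto

lemma U_in_X: "x \<in> X \<Longrightarrow> U x \<in> X"
  unfolding U_def using t by (intro convexD[OF convex_X] h_facts S_in_Y) auto

lemma W_in_X: "x \<in> X \<Longrightarrow> W x \<in> X" and S_W: "x \<in> X \<Longrightarrow> S (W x) = T x"
  using T_in_Y by (simp_all add: W_def)

lemma continuous_on_T: "continuous_on X T"
  unfolding T_def[abs_def]
  by (intro continuous_on_add continuous_on_scaleR continuous_on_const continuous_on_S f_facts(2))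

lemma continuous_on_h_S: "continuous_on X (\<lambda>x. egrad h (S x))"
  by (rule continuous_on_compose2[OF h_facts(2) continuous_on_S]) auto

lemma continuous_on_U: "continuous_on X U"
  unfolding U_def[abs_def]
  by (intro continuous_on_add continuous_on_scaleR continuous_on_const continuous_on_id continuous_on_h_S)

lemma continuous_on_W: "continuous_on X W"
  unfolding W_def[abs_def]
  by (rule continuous_on_compose2[OF continuous_on_S_inv continuous_on_T]) (auto intro: T_in_Y)

lemma T_strict_mono:
  assumes "x \<in> X" "x' \<in> X" "x \<noteq> x'"
  shows "0 < (T x - T x') \<bullet> (x - x')"
proof -
  have "T x - T x' = (1 - t) *\<^sub>R (S x - S x') + t *\<^sub>R (egrad f x - egrad f x')"
    by (simp add: T_def algebra_simps)
  then have "(T x - T x') \<bullet> (x - x')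
      = (1 - t) * ((S x - S x') \<bullet> (x - x')) + t * ((egrad f x - egrad f x') \<bullet> (x - x'))"
    by (simp add: inner_add_left)
  moreover have "0 < (1 - t) * ((S x - S x') \<bullet> (x - x'))"
    using S_strict_mono[OF assms] t by simp
  moreover have "0 \<le> t * ((egrad f x - egrad f x') \<bullet> (x - x'))"
    using convex_gradient_monotone[OF f_facts(1) f_facts(5,5)] assms t by simp
  ultimately show ?thesis by simp
qed

lemma U_strict_mono:
  assumes "x \<in> X" "x' \<in> X" "x \<noteq> x'"
  shows "0 < (U x - U x') \<bullet> (S x - S x')"
proof -
  have "U x - U x' = (1 - t) *\<^sub>R (x - x') + t *\<^sub>R (egrad h (S x) - egrad h (S x'))"
    by (simp add: U_def algebra_simps)
  then have "(U x - U x') \<bullet> (S x - S x')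
      = (1 - t) * ((x - x') \<bullet> (S x - S x')) + t * ((egrad h (S x) - egrad h (S x')) \<bullet> (S x - S x'))"
    by (simp add: inner_add_left)
  moreover have "0 < (1 - t) * ((x - x') \<bullet> (S x - S x'))"
    using S_strict_mono[OF assms] t by (simp add: inner_commute)
  moreover have "0 \<le> t * ((egrad h (S x) - egrad h (S x')) \<bullet> (S x - S x'))"
    using convex_gradient_monotone[OF h_facts(1) h_facts(5,5), of "S x'" "S x"] assms t by simp
  ultimately show ?thesis by simp
qed

lemma inj_on_U: "inj_on U X"
proof (rule inj_onI, rule ccontr)
  fix x x' assume "x \<in> X" "x' \<in> X" "U x = U x'" "x \<noteq> x'"
  then show False using U_strict_mono[of x x'] by simp
qed

lemma inj_on_W: "inj_on W X"
proof (rule inj_onI, rule ccontr)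
  fix x x' assume x: "x \<in> X" "x' \<in> X" "W x = W x'" "x \<noteq> x'"
  then have "T x = T x'" using S_W by metis
  then show False using T_strict_mono[of x x'] x by simp
qed

text \<open>The interpolation is defined through the dual law of \<open>\<rho>\<close>; substituting \<open>y = S x\<close> and
\<open>D\<Omega>\<^sup>* (S x) = x\<close> turns its transport map into \<open>U\<close>.\<close>

lemma primal_interpolation_eq:
  assumes "primal_displacement_interpolation M \<iota> X \<Omega> h \<mu>" and \<rho>: "\<mu> 0 \<in> borel_probs M"
  shows "\<mu> t = distr (\<mu> 0) borel_M (lift U)"
proof -
  let ?L = "restrict_space borel X" and ?LY = "restrict_space borel Y"
  let ?V = "\<lambda>y. (1 - t) *\<^sub>R egrad \<Omega>' y + t *\<^sub>R egrad h y"
  have \<mu>: "\<mu> t \<in> borel_probs M" and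
    law: "primal_law \<iota> X (\<mu> t) = distr (dual_law \<iota> X \<Omega> (\<mu> 0)) ?L ?V"
    using assms(1) t by (auto simp: primal_displacement_interpolation_def)
  have V_eq: "?V (S x) = U x" if "x \<in> X" for x
    using that by (simp add: U_def)
  have "continuous_on Y ?V"
  proof (intro continuous_on_add continuous_on_scaleR continuous_on_const h_facts(2))
    show "continuous_on Y (egrad \<Omega>')"
      by (rule continuous_on_eq[OF continuous_on_S_inv]) (metis S_S_inv S_inv_in_X egrad_\<Omega>')
  qed
  moreover have "?V y \<in> X" if "y \<in> Y" for y
    using V_eq[of "S_inv y"] U_in_X[of "S_inv y"] that by simp
  ultimately have Vm: "?V \<in> measurable ?LY ?L"
    by (intro measurable_restrict_space2 borel_measurable_continuous_on_restrict)
      (simp_all add: space_restrict_space)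
  have Sm: "dual_chart \<iota> \<Omega> \<in> measurable (\<mu> 0) ?LY"
    unfolding measurable_cong_sets[OF borel_probsD(2)[OF \<rho>] refl] dual_chart_def comp_def
    by (intro measurable_restrict_space2 measurable_chart_continuous continuous_on_S) simp
  have "distr (\<mu> t) ?L \<iota> = distr (\<mu> 0) ?L (?V \<circ> dual_chart \<iota> \<Omega>)"
    using law unfolding primal_law_def dual_law_def distr_distr[OF Vm Sm] .
  also have "\<dots> = distr (\<mu> 0) ?L (\<lambda>p. \<iota> (lift U p))"
    using borel_probsD(3)[OF \<rho>] V_eq U_in_X
    by (intro distr_cong) (simp_all add: lift_def dual_chart_def)
  finally show ?thesis
    using U_in_X
    by (intro law_eq_distr_lift[OF \<mu> \<rho> continuous_on_U _ measurable_\<iota> measurable_\<kappa>]) simp_all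
qed

lemma dual_interpolation_eq:
  assumes "dual_displacement_interpolation M \<iota> X \<Omega> f \<nu>" and \<rho>: "\<nu> 0 \<in> borel_probs M"
  shows "\<nu> t = distr (\<nu> 0) borel_M (lift W)"
proof -
  let ?L = "restrict_space borel X" and ?LY = "restrict_space borel Y"
  have \<nu>: "\<nu> t \<in> borel_probs M" and
    law: "dual_law \<iota> X \<Omega> (\<nu> t) = distr (primal_law \<iota> X (\<nu> 0)) ?LY T"
    using assms(1) t by (auto simp: dual_displacement_interpolation_def T_def[abs_def])
  have Tm: "T \<in> measurable ?L ?LY"
    by (intro measurable_restrict_space2 borel_measurable_continuous_on_restrict continuous_on_T)
      (simp_all add: space_restrict_space T_in_Y)
  have \<iota>m: "\<iota> \<in> measurable (\<nu> 0) ?L"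
    unfolding measurable_cong_sets[OF borel_probsD(2)[OF \<rho>] refl] by (rule measurable_\<iota>)
  have Sm: "dual_chart \<iota> \<Omega> \<in> measurable borel_M ?LY"
    unfolding dual_chart_def comp_def
    by (intro measurable_restrict_space2 measurable_chart_continuous continuous_on_S) simp
  have Sim: "S_inv \<in> measurable ?LY ?L"
    by (intro measurable_restrict_space2 borel_measurable_continuous_on_restrict continuous_on_S_inv)
      (simp_all add: space_restrict_space)
  have "distr (\<nu> t) ?LY (dual_chart \<iota> \<Omega>) = distr (\<nu> 0) ?LY (T \<circ> \<iota>)"
    using law unfolding primal_law_def dual_law_def distr_distr[OF Tm \<iota>m] .
  also have "\<dots> = distr (\<nu> 0) ?LY (\<lambda>p. dual_chart \<iota> \<Omega> (lift W p))"
    using borel_probsD(3)[OF \<rho>] W_in_X S_W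
    by (intro distr_cong) (simp_all add: lift_def dual_chart_def)
  finally show ?thesis
    using W_in_X
    by (intro law_eq_distr_lift[OF \<nu> \<rho> continuous_on_W _ Sm measurable_compose[OF Sim measurable_\<kappa>]])
      (simp_all add: dual_chart_def)
qed


text \<open>The convex function \<open>(1 - t) \<Omega> + t f\<close> has gradient \<open>T\<close>; it and its Legendre transform, evaluated at
\<open>T x\<close>, are the potentials.\<close>

lemma BW_div_start_dual:
  assumes \<rho>: "\<rho> \<in> borel_probs M"
  shows "BW_div \<iota> X \<Omega> \<rho> (distr \<rho> borel_M (lift W)) = enn2ereal (transport_cost \<rho> id W)"
proof -
  let ?\<phi> = "\<lambda>x. (1 - t) * \<Omega> x + t * f x"
  have "BW_div \<iota> X \<Omega> (distr \<rho> borel_M (lift id)) (distr \<rho> borel_M (lift W))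
      = enn2ereal (transport_cost \<rho> id W)"
  proof (rule BW_div_eq_transport_cost[OF \<rho>, where \<alpha> = ?\<phi> and \<beta> = "\<lambda>x. x \<bullet> T x - ?\<phi> x"])
    show "continuous_on X ?\<phi>"
      by (intro continuous_on_add continuous_on_mult continuous_on_const continuous_on_\<Omega> f_facts(6))
    then show "continuous_on X (\<lambda>x. x \<bullet> T x - ?\<phi> x)"
      by (intro continuous_on_diff continuous_on_inner continuous_on_id continuous_on_T)
    fix x x' assume x: "x \<in> X" "x' \<in> X"
    have "(1 - t) * (\<Omega> x' + S x' \<bullet> (x - x')) \<le> (1 - t) * \<Omega> x"
      using \<Omega>_gradient_inequality[OF x(2,1)] t by (intro mult_left_mono) auto
    moreover have "t * (f x' + egrad f x' \<bullet> (x - x')) \<le> t * f x"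
      using convex_on_gradient_inequality[OF f_facts(1) f_facts(5)[OF x(2)] x(2,1)] t
      by (intro mult_left_mono) auto
    moreover have "x \<bullet> T x' - x' \<bullet> T x'
        = (1 - t) * (S x' \<bullet> (x - x')) + t * (egrad f x' \<bullet> (x - x'))"
      by (simp add: T_def inner_add_right inner_diff_right inner_commute right_diff_distrib)
    ultimately show "id x \<bullet> S (W x') \<le> ?\<phi> x + (x' \<bullet> T x' - ?\<phi> x')"
      by (simp add: S_W[OF x(2)] distrib_left)
  next
    fix x assume "x \<in> X"
    then show "id x \<bullet> S (W x) = ?\<phi> x + (x \<bullet> T x - ?\<phi> x)" by (simp add: S_W)
  qed (use W_in_X inj_on_W in \<open>simp_all add: continuous_on_W continuous_on_id inj_on_def\<close>)
  then show ?thesis by (simp only: distr_lift_id[OF \<rho>])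
qed

text \<open>Dually, the potentials come from the convex function \<open>(1 - t) \<Omega>\<^sup>* + t h\<close>, whose gradient at \<open>S x\<close> is
\<open>U x\<close>.\<close>

lemma BW_div_primal_start:
  assumes \<rho>: "\<rho> \<in> borel_probs M"
  shows "BW_div \<iota> X \<Omega> (distr \<rho> borel_M (lift U)) \<rho> = enn2ereal (transport_cost \<rho> U id)"
proof -
  let ?\<chi> = "\<lambda>x. (1 - t) * \<Omega>' (S x) + t * h (S x)"
  have "BW_div \<iota> X \<Omega> (distr \<rho> borel_M (lift U)) (distr \<rho> borel_M (lift id))
      = enn2ereal (transport_cost \<rho> U id)"
  proof (rule BW_div_eq_transport_cost[OF \<rho>, where \<beta> = ?\<chi> and \<alpha> = "\<lambda>x. U x \<bullet> S x - ?\<chi> x"])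
    have "continuous_on X (\<lambda>x. h (S x))"
      by (rule continuous_on_compose2[OF h_facts(6) continuous_on_S]) auto
    then show "continuous_on X ?\<chi>"
      by (intro continuous_on_add continuous_on_mult continuous_on_const continuous_on_\<Omega>'_S)
    then show "continuous_on X (\<lambda>x. U x \<bullet> S x - ?\<chi> x)"
      by (intro continuous_on_diff continuous_on_inner continuous_on_U continuous_on_S)
    fix x x' assume x: "x \<in> X" "x' \<in> X"
    have "(1 - t) * (\<Omega>' (S x) + x \<bullet> (S x' - S x)) \<le> (1 - t) * \<Omega>' (S x')"
      using \<Omega>'_gradient_inequality[OF x] t by (intro mult_left_mono) auto
    moreover have "t * (h (S x) + egrad h (S x) \<bullet> (S x' - S x)) \<le> t * h (S x')"
      using convex_on_gradient_inequality[OF h_facts(1) h_facts(5)[OF S_in_Y[OF x(1)]]] x t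
      by (intro mult_left_mono) auto
    moreover have "U x \<bullet> S x' - U x \<bullet> S x
        = (1 - t) * (x \<bullet> (S x' - S x)) + t * (egrad h (S x) \<bullet> (S x' - S x))"
      by (simp add: U_def inner_add_left inner_diff_right right_diff_distrib)
    ultimately show "U x \<bullet> S (id x') \<le> (U x \<bullet> S x - ?\<chi> x) + ?\<chi> x'"
      by (simp add: distrib_left)
  qed (use U_in_X inj_on_U in \<open>simp_all add: continuous_on_U continuous_on_id inj_on_def\<close>)
  then show ?thesis by (simp only: distr_lift_id[OF \<rho>])
qed

text \<open>On the line, strict monotonicity against \<open>x\<close> or against \<open>S x\<close> means being increasing, so \<open>U\<close> and \<open>T\<close>
increase together. In higher dimensions the pair \<open>(U, T)\<close> need not be monotone.\<close>

lemma BW_div_primal_dual_dim_1: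
  assumes dim: "CARD('n) = 1" and \<rho>: "\<rho> \<in> borel_probs M"
  shows "BW_div \<iota> X \<Omega> (distr \<rho> borel_M (lift U)) (distr \<rho> borel_M (lift W))
    = enn2ereal (transport_cost \<rho> U W)"
proof -
  obtain i :: 'n where i: "UNIV = {i}"
    using dim by (auto simp: card_1_singleton_iff)
  have inner_i: "x \<bullet> y = x $ i * y $ i" for x y :: "real^'n"
    by (simp add: inner_vec_def i)
  have mono: "0 \<le> (U x - U x') \<bullet> (T x - T x')" if x: "x \<in> X" "x' \<in> X" for x x'
  proof (cases "x = x'")
    case False
    have "0 < (S x - S x') $ i * (x - x') $ i" "0 < (T x - T x') $ i * (x - x') $ i"
      "0 < (U x - U x') $ i * (S x - S x') $ i"
      using S_strict_mono[OF x False] T_strict_mono[OF x False] U_strict_mono[OF x False]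
      by (simp_all only: inner_i)
    then show ?thesis
      unfolding inner_i by (auto simp only: zero_less_mult_iff zero_le_mult_iff)
  qed simp
  obtain \<psi> where \<psi>: "continuous_on X \<psi>"
    "\<And>x y. x \<in> X \<Longrightarrow> y \<in> X \<Longrightarrow> \<psi> y + T y \<bullet> (U x - U y) \<le> \<psi> x"
    using monotone_pair_potential_dim_1[OF dim open_X convex_connected[OF convex_X]
        continuous_on_U inj_on_U continuous_on_T mono] by blast
  show ?thesis
  proof (rule BW_div_eq_transport_cost[OF \<rho>, where \<alpha> = \<psi> and \<beta> = "\<lambda>x. U x \<bullet> T x - \<psi> x"])
    show "continuous_on X (\<lambda>x. U x \<bullet> T x - \<psi> x)"
      by (intro continuous_on_diff continuous_on_inner continuous_on_U continuous_on_T \<psi>(1))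
    fix x x' assume x: "x \<in> X" "x' \<in> X"
    then show "U x \<bullet> S (W x') \<le> \<psi> x + (U x' \<bullet> T x' - \<psi> x')"
      using \<psi>(2)[OF x] by (simp add: S_W inner_diff_right inner_commute)
  qed (use U_in_X W_in_X \<psi>(1) in \<open>simp_all add: continuous_on_U continuous_on_W inj_on_U inj_on_W S_W\<close>)
qed

definition otto_density :: "'m \<Rightarrow> real" where
  "otto_density p = (egrad h (S (\<iota> p)) - \<iota> p) \<bullet> (egrad f (\<iota> p) - S (\<iota> p))"

lemma measurable_otto_density: "otto_density \<in> borel_measurable borel_M"
  unfolding otto_density_def[abs_def]
  by (intro measurable_chart_continuous continuous_on_inner continuous_on_diff continuous_on_id
      continuous_on_S continuous_on_h_S f_facts(2))

lemma otto_inner_eq: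
  assumes \<rho>: "\<rho> \<in> borel_probs M"
  shows "otto_inner M \<iota> X \<Omega> h f \<rho> = ext_integral \<rho> otto_density"
  unfolding otto_inner_def
proof (rule ext_integral_cong)
  fix p assume "p \<in> space \<rho>"
  then have p: "p \<in> topspace M" using borel_probsD[OF \<rho>] by simp
  show "bregman_metric \<iota> \<Omega> p
      (riemannian_grad M \<iota> \<Omega> ((\<lambda>x. f x - \<Omega> x) \<circ> \<iota>) p)
      (riemannian_grad M \<iota> \<Omega> ((\<lambda>y. h y - \<Omega>' y) \<circ> dual_chart \<iota> \<Omega>) p) = otto_density p"
    unfolding otto_density_def using p by (intro otto_integrand_eq f_facts h_facts) simp_all
qed

lemma divergence_defect:
  assumes p: "p \<in> topspace M"
  shows "(B (lift id p) (lift W p) + B (lift U p) (lift id p)) - B (lift U p) (lift W p)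
    = t\<^sup>2 * otto_density p"
proof -
  define x where "x = \<iota> p"
  have x: "x \<in> X" using p by (simp add: x_def)
  have "U x - x = t *\<^sub>R (egrad h (S x) - x)" "T x - S x = t *\<^sub>R (egrad f x - S x)"
    by (simp_all add: U_def T_def algebra_simps)
  then have "t\<^sup>2 * otto_density p = (U x - x) \<bullet> (T x - S x)"
    by (simp add: otto_density_def x_def power2_eq_square)
  also have "\<dots> = x \<bullet> S x - x \<bullet> T x - U x \<bullet> S x + U x \<bullet> T x"
    by (simp add: inner_diff_left inner_diff_right)
  finally show ?thesis
    using x U_in_X[OF x] W_in_X[OF x]
    by (simp add: B_eq lift_def S_W \<Omega>'_S flip: x_def)
qed

lemma scaled_otto_inner_eq:
  assumes \<rho>: "\<rho> \<in> borel_probs M"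
    and fin: "transport_cost \<rho> id W + transport_cost \<rho> U id < \<infinity> \<or> transport_cost \<rho> U W < \<infinity>"
  shows "ereal (t\<^sup>2) * otto_inner M \<iota> X \<Omega> h f \<rho>
    = enn2ereal (transport_cost \<rho> id W + transport_cost \<rho> U id) - enn2ereal (transport_cost \<rho> U W)"
proof -
  note D = borel_probsD[OF \<rho>]
  let ?g = "\<lambda>p. B (lift id p) (lift W p) + B (lift U p) (lift id p)"
  let ?k = "\<lambda>p. B (lift U p) (lift W p)"
  have maps: "continuous_on X id" "id \<in> X \<rightarrow> X" "U \<in> X \<rightarrow> X" "W \<in> X \<rightarrow> X"
    using U_in_X W_in_X by (simp_all add: continuous_on_id)
  note m = measurable_B_lift[OF \<rho> maps(1,2) continuous_on_W maps(4)]
    measurable_B_lift[OF \<rho> continuous_on_U maps(3) maps(1,2)]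
    measurable_B_lift[OF \<rho> continuous_on_U maps(3) continuous_on_W maps(4)]
  have nonneg: "0 \<le> B (lift id p) (lift W p)" "0 \<le> B (lift U p) (lift id p)" "0 \<le> ?k p"
    if "p \<in> space \<rho>" for p
    using that D(3) by (auto intro!: B_nonneg lift_in_M maps)
  have g_int: "(\<integral>\<^sup>+p. ennreal (?g p) \<partial>\<rho>) = transport_cost \<rho> id W + transport_cost \<rho> U id"
  proof -
    have "(\<integral>\<^sup>+p. ennreal (?g p) \<partial>\<rho>)
        = (\<integral>\<^sup>+p. ennreal (B (lift id p) (lift W p)) + ennreal (B (lift U p) (lift id p)) \<partial>\<rho>)"
      by (intro nn_integral_cong ennreal_plus nonneg)
    also have "\<dots> = transport_cost \<rho> id W + transport_cost \<rho> U id"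
      unfolding transport_cost_def
      by (intro nn_integral_add measurable_compose[OF m(1) measurable_ennreal]
          measurable_compose[OF m(2) measurable_ennreal])
    finally show ?thesis .
  qed
  have om: "otto_density \<in> borel_measurable \<rho>"
    unfolding measurable_cong_sets[OF D(2) refl] by (rule measurable_otto_density)
  have "ereal (t\<^sup>2) * otto_inner M \<iota> X \<Omega> h f \<rho> = ext_integral \<rho> (\<lambda>p. t\<^sup>2 * otto_density p)"
    unfolding otto_inner_eq[OF \<rho>] by (rule ext_integral_cmult[OF _ om, symmetric]) simp
  also have "\<dots> = ext_integral \<rho> (\<lambda>p. ?g p - ?k p)"
    using D(3) by (intro ext_integral_cong divergence_defect[symmetric]) simp
  also have "\<dots> = enn2ereal (\<integral>\<^sup>+p. ennreal (?g p) \<partial>\<rho>) - enn2ereal (\<integral>\<^sup>+p. ennreal (?k p) \<partial>\<rho>)"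
  proof (rule ext_integral_diff_nonneg)
    show "?g \<in> borel_measurable \<rho>" by (intro borel_measurable_add m)
    show "?k \<in> borel_measurable \<rho>" by (rule m)
    show "(\<integral>\<^sup>+p. ennreal (?g p) \<partial>\<rho>) < \<infinity> \<or> (\<integral>\<^sup>+p. ennreal (?k p) \<partial>\<rho>) < \<infinity>"
      unfolding g_int using fin by (simp add: transport_cost_def)
  qed (auto intro: nonneg add_nonneg_nonneg)
  finally show ?thesis by (simp only: g_int transport_cost_def)
qed

end

theorem theorem3p6:
  fixes M :: "'m topology" and \<iota> :: "'m \<Rightarrow> real^'n"
    and X :: "(real^'n) set" and \<Omega> f h :: "real^'n \<Rightarrow> real"
    and \<rho> :: "'m measure" and \<mu> \<nu> :: "real \<Rightarrow> 'm measure"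
  assumes "bregman_manifold M \<iota> X \<Omega>"
    and "\<rho> \<in> borel_probs M"
    and "smooth_convex_gradient (dual_domain X \<Omega>) X h"
    and "smooth_convex_gradient X (dual_domain X \<Omega>) f"
    and "primal_displacement_interpolation M \<iota> X \<Omega> h \<mu>" and "\<mu> 0 = \<rho>"
    and "dual_displacement_interpolation M \<iota> X \<Omega> f \<nu>" and "\<nu> 0 = \<rho>"
    and "admissible_pair \<iota> X \<Omega> \<rho> (\<mu> 1)"
    and "admissible_pair \<iota> X \<Omega> \<rho> (\<nu> 1)"
  shows "\<forall>t\<in>{0..<1}.
      BW_div \<iota> X \<Omega> \<rho> (\<nu> t) + BW_div \<iota> X \<Omega> (\<mu> t) \<rho> - BW_div \<iota> X \<Omega> (\<mu> t) (\<nu> t)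
        \<ge> ereal (t\<^sup>2) * otto_inner M \<iota> X \<Omega> h f \<rho> \<and>
      (CARD('n) = 1 \<and>
       defined_diff (BW_div \<iota> X \<Omega> \<rho> (\<nu> t) + BW_div \<iota> X \<Omega> (\<mu> t) \<rho>) (BW_div \<iota> X \<Omega> (\<mu> t) (\<nu> t)) \<longrightarrow>
       BW_div \<iota> X \<Omega> \<rho> (\<nu> t) + BW_div \<iota> X \<Omega> (\<mu> t) \<rho> - BW_div \<iota> X \<Omega> (\<mu> t) (\<nu> t)
         = ereal (t\<^sup>2) * otto_inner M \<iota> X \<Omega> h f \<rho>)"
proof (rule ballI)
  fix t :: real assume t: "t \<in> {0..<1}"
  interpret displacement M \<iota> X \<Omega> f h t
    using assms(1,3,4) t by unfold_locales auto
  note \<rho> = assms(2)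
  have \<mu>t: "\<mu> t = distr \<rho> borel_M (lift U)"
    using primal_interpolation_eq[OF assms(5)] assms(2,6) by simp
  have \<nu>t: "\<nu> t = distr \<rho> borel_M (lift W)"
    using dual_interpolation_eq[OF assms(7)] assms(2,8) by simp
  let ?E = "transport_cost \<rho> id W + transport_cost \<rho> U id" and ?c = "transport_cost \<rho> U W"
  let ?C = "BW_div \<iota> X \<Omega> (\<mu> t) (\<nu> t)"
  have sum: "BW_div \<iota> X \<Omega> \<rho> (\<nu> t) + BW_div \<iota> X \<Omega> (\<mu> t) \<rho> = enn2ereal ?E"
    unfolding \<mu>t \<nu>t BW_div_start_dual[OF \<rho>] BW_div_primal_start[OF \<rho>] by (rule plus_ennreal.rep_eq[symmetric])
  have le: "?C \<le> enn2ereal ?c"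
    unfolding \<mu>t \<nu>t using U_in_X W_in_X
    by (intro BW_div_le_transport_cost[OF \<rho>] continuous_on_U continuous_on_W) auto
  have "ereal (t\<^sup>2) * otto_inner M \<iota> X \<Omega> h f \<rho> \<le> enn2ereal ?E - ?C"
  proof (cases "?E = \<infinity>")
    case True
    show ?thesis unfolding True by simp
  next
    case False
    then have "ereal (t\<^sup>2) * otto_inner M \<iota> X \<Omega> h f \<rho> = enn2ereal ?E - enn2ereal ?c"
      by (intro scaled_otto_inner_eq[OF \<rho>]) (simp add: less_top)
    also have "\<dots> \<le> enn2ereal ?E - ?C"
      by (rule ereal_minus_mono[OF order_refl le])
    finally show ?thesis .
  qed
  moreover have "enn2ereal ?E - ?C = ereal (t\<^sup>2) * otto_inner M \<iota> X \<Omega> h f \<rho>"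
    if dim: "CARD('n) = 1" and fin: "defined_diff (enn2ereal ?E) ?C"
  proof -
    have C: "?C = enn2ereal ?c"
      unfolding \<mu>t \<nu>t by (rule BW_div_primal_dual_dim_1[OF dim \<rho>])
    have "?E < \<infinity> \<or> ?c < \<infinity>"
    proof (rule ccontr)
      assume "\<not> ?thesis"
      then have "?E = top" "?c = top" by (auto simp flip: less_top)
      then show False using fin by (simp add: defined_diff_def C)
    qed
    then show ?thesis
      unfolding C by (rule scaled_otto_inner_eq[OF \<rho>, symmetric])
  qed
  ultimately show "BW_div \<iota> X \<Omega> \<rho> (\<nu> t) + BW_div \<iota> X \<Omega> (\<mu> t) \<rho> - ?C
        \<ge> ereal (t\<^sup>2) * otto_inner M \<iota> X \<Omega> h f \<rho> \<and>
      (CARD('n) = 1 \<and>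
       defined_diff (BW_div \<iota> X \<Omega> \<rho> (\<nu> t) + BW_div \<iota> X \<Omega> (\<mu> t) \<rho>) ?C \<longrightarrow>
       BW_div \<iota> X \<Omega> \<rho> (\<nu> t) + BW_div \<iota> X \<Omega> (\<mu> t) \<rho> - ?C
         = ereal (t\<^sup>2) * otto_inner M \<iota> X \<Omega> h f \<rho>)"
    unfolding sum by blast
qed

end
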